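(* Let $F:\mathbb{R}^d\to\mathbb{R}^d$ be an operator and $R:\mathbb{R}^d\to\mathbb{R}\cup\{+\infty\}$ a proper lower semicontinuous convex function such that the problem of finding $x_*$ with $\langle F(x_* ),x-x_*\rangle+R(x)-R(x_* )\ge0$ for all $x\in\mathbb{R}^d$ has a unique solution $x_*$. Assume $F$ is $\mu$-quasi-strongly monotone and $\ell$-star-cocoercive around $x_*$ ($\mu,\ell>0$), and that the estimators $g_k$ satisfy the estimator assumption with constants $A,B,C,D_1,D_2\ge0$, $\rho\in(0,1]$ and variables $\sigma_k$. Let $M>\frac B\rho$, $$\gamma\le\min\left\{\frac1\mu,\frac1{2(A+MC)}\right\},\qquad\tau:=\min\left\{\gamma\mu,\ p^2,\ \rho-\frac BM\right\},$$ with $\gamma>0$, and $$V_k:=\|x_k-x_*\|^2+\frac{\gamma^2}{p^2}\|h_k-F(x_* )\|^2+M\gamma^2\sigma_k^2.$$ Then the iterates of ProxSkip-VIP satisfy, for all $K\ge0$, $$\mathbb{E}[V_K]\le(1-\tau)^KV_0+\frac{\gamma^2(D_1+MD_2)}{\tau}.$$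
   Context: ProxSkip-VIP: given $x_0,h_0\in\mathbb{R}^d$, $\gamma>0$, $p\in(0,1]$, for $k=0,1,\dots$: set $\widehat x_{k+1}=x_k-\gamma(g_k-h_k)$; flip an independent coin $\theta_k$ with $\mathbb{P}(\theta_k=1)=p$, $\mathbb{P}(\theta_k=0)=1-p$; if $\theta_k=1$ set $x_{k+1}=\mathrm{prox}_{\frac\gamma pR}\left(\widehat x_{k+1}-\frac\gamma ph_k\right)$, otherwise $x_{k+1}=\widehat x_{k+1}$; finally $h_{k+1}=h_k+\frac p\gamma(x_{k+1}-\widehat x_{k+1})$. Here $\mathrm{prox}_{aR}(x)=\arg\min_v\left\{R(v)+\frac1{2a}\|v-x\|^2\right\}$. $\mu$-quasi-strongly monotone: $\langle F(x)-F(x_* ),x-x_*\rangle\ge\mu\|x-x_*\|^2$ for all $x$. $\ell$-star-cocoercive: $\langle F(x)-F(x_* ),x-x_*\rangle\ge\frac1\ell\|F(x)-F(x_* )\|^2$ for all $x$. Estimator assumption: for all $k\ge0$ (expectations conditional on the history up to the iterate $x_k$), $\mathbb{E}[g_k]=F(x_k)$, and there are constants $A,B,C,D_1,D_2\ge0$, $\rho\in(0,1]$ and (possibly random) non-negative variables $\{\sigma_k\}_{k\ge0}$ with $$\mathbb{E}\|g_k-F(x_* )\|^2\le2A\langle F(x_k)-F(x_* ),x_k-x_*\rangle+B\sigma_k^2+D_1,$$ $$\mathbb{E}[\sigma_{k+1}^2]\le2C\langle F(x_k)-F(x_* ),x_k-x_*\rangle+(1-\rho)\sigma_k^2+D_2.$$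 The initial data $x_0,h_0,\sigma_0$ are deterministic, and $M>0$. *)

theory Defs
  imports "HOL-Probability.Probability"
begin

section \<open>The variational inequality and the proximal operator\<close>

definition proper_fun :: "('a \<Rightarrow> ereal) \<Rightarrow> bool" where
  "proper_fun R \<longleftrightarrow> (\<forall>x. R x \<noteq> -\<infinity>) \<and> (\<exists>x. R x \<noteq> \<infinity>)"

definition lsc_fun :: "('a::topological_space \<Rightarrow> ereal) \<Rightarrow> bool" where
  "lsc_fun R \<longleftrightarrow> (\<forall>x. R x \<le> Liminf (at x) R)"

definition convex_fun :: "('a::real_vector \<Rightarrow> ereal) \<Rightarrow> bool" where
  "convex_fun R \<longleftrightarrow> (\<forall>x y t. 0 < t \<and> t < 1 \<longrightarrow>
     R ((1 - t) *\<^sub>R x + t *\<^sub>R y) \<le> ereal (1 - t) * R x + ereal t * R y)"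

text \<open>On \<^typ>\<open>ereal\<close>, \<open>\<infinity> - \<infinity> = \<infinity>\<close>. For a proper \<open>R\<close> the definition below nevertheless
  forces \<open>R xs\<close> to be finite: if \<open>R xs = \<infinity>\<close>, the inequality fails at every \<open>x\<close> with
  \<open>R x < \<infinity>\<close>.\<close>

definition vi_solution :: "('a::real_inner \<Rightarrow> 'a) \<Rightarrow> ('a \<Rightarrow> ereal) \<Rightarrow> 'a \<Rightarrow> bool" where
  "vi_solution F R xs \<longleftrightarrow> (\<forall>x. ereal (F xs \<bullet> (x - xs)) + R x - R xs \<ge> 0)"

definition quasi_strongly_monotone :: "real \<Rightarrow> ('a::real_inner \<Rightarrow> 'a) \<Rightarrow> 'a \<Rightarrow> bool" where
  "quasi_strongly_monotone \<mu> F xs \<longleftrightarrow>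
     (\<forall>x. (F x - F xs) \<bullet> (x - xs) \<ge> \<mu> * (norm (x - xs))\<^sup>2)"

definition star_cocoercive :: "real \<Rightarrow> ('a::real_inner \<Rightarrow> 'a) \<Rightarrow> 'a \<Rightarrow> bool" where
  "star_cocoercive l F xs \<longleftrightarrow>
     (\<forall>x. (F x - F xs) \<bullet> (x - xs) \<ge> 1 / l * (norm (F x - F xs))\<^sup>2)"

definition prox :: "real \<Rightarrow> ('a::real_normed_vector \<Rightarrow> ereal) \<Rightarrow> 'a \<Rightarrow> 'a" where
  "prox a R x = (ARG_MIN (\<lambda>v. R v + ereal (1 / (2 * a) * (norm (v - x))\<^sup>2)) v. True)"

section \<open>The method\<close>

text \<open>One run of the method: \<open>g\<close> and \<open>\<theta>\<close> are the realised estimators and coin flips.\<close>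

definition proxskip_vip ::
  "real \<Rightarrow> real \<Rightarrow> ('a::real_normed_vector \<Rightarrow> ereal) \<Rightarrow> 'a \<Rightarrow> 'a \<Rightarrow>
    (nat \<Rightarrow> 'a) \<Rightarrow> (nat \<Rightarrow> bool) \<Rightarrow> (nat \<Rightarrow> 'a) \<Rightarrow> (nat \<Rightarrow> 'a) \<Rightarrow> bool" where
  "proxskip_vip \<gamma> p R x0 h0 g \<theta> x h \<longleftrightarrow>
     x 0 = x0 \<and> h 0 = h0 \<and>
     (\<forall>k. let xhat = x k - \<gamma> *\<^sub>R (g k - h k) in
        x (Suc k) = (if \<theta> k then prox (\<gamma> / p) R (xhat - (\<gamma> / p) *\<^sub>R h k) else xhat) \<and>
        h (Suc k) = h k + (p / \<gamma>) *\<^sub>R (x (Suc k) - xhat))"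

section \<open>The probabilistic model\<close>

text \<open>\<open>H k\<close> is the history up to the iterate \<open>x k\<close>. It is any filtration that contains the
  estimators and coins of the steps before \<open>k\<close> and the variables \<open>\<sigma> 0, \<dots>, \<sigma> k\<close>. It may be larger
  than the sigma-algebra they generate, to allow for further state of the estimator. With
  deterministic initial data, \<open>x k\<close> and \<open>h k\<close> are functions of these variables.\<close>

definition history ::
  "'w measure \<Rightarrow> (nat \<Rightarrow> 'w measure) \<Rightarrow> (nat \<Rightarrow> 'w \<Rightarrow> 'a::topological_space) \<Rightarrow>
    (nat \<Rightarrow> 'w \<Rightarrow> bool) \<Rightarrow> (nat \<Rightarrow> 'w \<Rightarrow> real) \<Rightarrow> bool" where
  "history P H g \<theta> \<sigma> \<longleftrightarrow>
     filtration (space P) H \<and>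
     (\<forall>k. subalgebra P (H k) \<and>
          g k \<in> borel_measurable (H (Suc k)) \<and>
          \<theta> k \<in> measurable (H (Suc k)) (count_space UNIV) \<and>
          \<sigma> k \<in> borel_measurable (H k))"

text \<open>Each coin is independent of everything that precedes it: of the sigma-algebra generated by
  the history \<open>H k\<close> and \<open>g k\<close> together.\<close>

definition independent_coins ::
  "'w measure \<Rightarrow> (nat \<Rightarrow> 'w measure) \<Rightarrow> (nat \<Rightarrow> 'w \<Rightarrow> 'a::topological_space) \<Rightarrow>
    (nat \<Rightarrow> 'w \<Rightarrow> bool) \<Rightarrow> real \<Rightarrow> bool" where
  "independent_coins P H g \<theta> p \<longleftrightarrow>
     (\<forall>k. measure P {\<omega> \<in> space P. \<theta> k \<omega>} = p \<and>
          prob_space.indep_set P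
            {\<theta> k -` S \<inter> space P | S. S \<in> sets (count_space UNIV)}
            (sigma_sets (space P) (sets (H k) \<union> {g k -` S \<inter> space P | S. S \<in> sets borel})))"

text \<open>The library has conditional expectations of real functions only.\<close>

definition vec_cond_exp ::
  "'w measure \<Rightarrow> 'w measure \<Rightarrow> ('w \<Rightarrow> 'a::euclidean_space) \<Rightarrow> 'w \<Rightarrow> 'a" where
  "vec_cond_exp P G f = (\<lambda>\<omega>. \<Sum>b\<in>Basis. real_cond_exp P G (\<lambda>\<omega>'. f \<omega>' \<bullet> b) \<omega> *\<^sub>R b)"

text \<open>The two moment bounds use \<^const>\<open>nn_cond_exp\<close>, the conditional expectation of
  \<open>[0, \<infinity>]\<close>-valued functions, so that they do not presuppose finite second moments. When
  \<open>F\<close> is star-cocoercive the right-hand sides are non-negative, so \<^const>\<open>ennreal\<close> does not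
  truncate them.\<close>

definition estimator_assumption ::
  "'w measure \<Rightarrow> (nat \<Rightarrow> 'w measure) \<Rightarrow> ('a::euclidean_space \<Rightarrow> 'a) \<Rightarrow> 'a \<Rightarrow>
    (nat \<Rightarrow> 'w \<Rightarrow> 'a) \<Rightarrow> (nat \<Rightarrow> 'w \<Rightarrow> 'a) \<Rightarrow> (nat \<Rightarrow> 'w \<Rightarrow> real) \<Rightarrow>
    real \<Rightarrow> real \<Rightarrow> real \<Rightarrow> real \<Rightarrow> real \<Rightarrow> real \<Rightarrow> bool" where
  "estimator_assumption P H F xs x g \<sigma> A B C D1 D2 \<rho> \<longleftrightarrow>
     A \<ge> 0 \<and> B \<ge> 0 \<and> C \<ge> 0 \<and> D1 \<ge> 0 \<and> D2 \<ge> 0 \<and> 0 < \<rho> \<and> \<rho> \<le> 1 \<and>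
     (\<forall>k. \<forall>\<omega>\<in>space P. \<sigma> k \<omega> \<ge> 0) \<and>
     (\<forall>k. integrable P (g k) \<and>
          (AE \<omega> in P. vec_cond_exp P (H k) (g k) \<omega> = F (x k \<omega>)) \<and>
          (AE \<omega> in P. nn_cond_exp P (H k) (\<lambda>\<omega>'. ennreal ((norm (g k \<omega>' - F xs))\<^sup>2)) \<omega>
             \<le> ennreal (2 * A * ((F (x k \<omega>) - F xs) \<bullet> (x k \<omega> - xs))
                         + B * (\<sigma> k \<omega>)\<^sup>2 + D1)) \<and>
          (AE \<omega> in P. nn_cond_exp P (H k) (\<lambda>\<omega>'. ennreal ((\<sigma> (Suc k) \<omega>')\<^sup>2)) \<omega>
             \<le> ennreal (2 * C * ((F (x k \<omega>) - F xs) \<bullet> (x k \<omega> - xs))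
                         + (1 - \<rho>) * (\<sigma> k \<omega>)\<^sup>2 + D2)))"

definition lyapunov ::
  "real \<Rightarrow> real \<Rightarrow> real \<Rightarrow> ('a::real_normed_vector \<Rightarrow> 'a) \<Rightarrow> 'a \<Rightarrow> 'a \<Rightarrow> 'a \<Rightarrow> real \<Rightarrow> real" where
  "lyapunov \<gamma> p M F xs x h s =
     (norm (x - xs))\<^sup>2 + \<gamma>\<^sup>2 / p\<^sup>2 * (norm (h - F xs))\<^sup>2 + M * \<gamma>\<^sup>2 * s\<^sup>2"

text \<open>The step-size bound is an extended real, so that \<open>1 / (2 * (A + M * C))\<close> is \<open>\<infinity>\<close>, and not
  \<open>0\<close>, when \<open>A + M * C = 0\<close>.\<close>

definition stepsize_bound :: "real \<Rightarrow> real \<Rightarrow> real \<Rightarrow> real \<Rightarrow> ereal" where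
  "stepsize_bound \<mu> A M C = min (1 / ereal \<mu>) (1 / ereal (2 * (A + M * C)))"

end

theory Submission
  imports Defs
begin

text \<open>The proof follows the squared distances in the Lyapunov function through one step of the method.

  Write \<open>hs = F xs\<close>. The variational inequality says that \<open>- F xs\<close> is a subgradient of \<open>R\<close> at \<open>xs\<close>, so
  \<open>xs\<close> is the proximal point of \<open>xs - (\<gamma> / p) hs\<close> (\<open>vi_solution_resolvent_point\<close>). A proximal step
  from \<open>xh - (\<gamma> / p) h\<close> has residual \<open>- (\<gamma> / p) h'\<close>, where \<open>h'\<close> is the updated control variate.
  Firm nonexpansiveness of the proximal operator therefore bounds
  \<open>\<parallel>x' - xs\<parallel>\<^sup>2 + (\<gamma> / p)\<^sup>2 \<parallel>h' - hs\<parallel>\<^sup>2\<close> by \<open>\<parallel>xh - xs - (\<gamma> / p) (h - hs)\<parallel>\<^sup>2\<close>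
  (\<open>proxskip_step_decrease\<close>). If the step is skipped, the same quantity is that square without its
  cross term. The cross term thus appears with probability \<open>p\<close>, and its mean is exactly what
  completes the square of \<open>x - xs - \<gamma> (g - hs)\<close>, at the gain of a factor \<open>1 - p\<^sup>2\<close> in front of the error
  of \<open>h\<close> (\<open>proxskip_coin_average\<close>, \<open>expected_skip_step_decrease\<close>). The skipping costs nothing in the
  \<open>x\<close> part: what remains is the error of a plain stochastic forward step.

  Expanding that error, unbiasedness turns the linear term into the drift
  \<open>\<langle>F x - F xs, x - xs\<rangle>\<close> and the moment bounds control the quadratic one (\<open>vec_cond_exp_inner\<close>,
  \<open>estimator_moments\<close>). Half of the drift pays for the variance, the other half contracts the distance
  by quasi-strong monotonicity (\<open>lyapunov_contraction_arith\<close>). The mean of the Lyapunov function then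
  satisfies \<open>e (k + 1) \<le> (1 - \<tau>) e k + \<gamma>\<^sup>2 (D1 + M D2)\<close>, and the geometric series gives the claim.

  On the measure-theoretic side, square-integrability of all quantities is proved along with the
  bound, by induction on the step. The iterates are measurable because the proximal operator is
  nonexpansive, hence continuous.\<close>

section \<open>Minimisers of lower semicontinuous functions\<close>

lemma lsc_eventually_gt:
  assumes lsc: "lsc_fun R" and c: "ereal c < R v"
  shows "\<forall>\<^sub>F w in nhds v. ereal c < R w"
proof -
  have "ereal c < Liminf (at v) R"
    using lsc c unfolding lsc_fun_def by (metis less_le_trans)
  then have "\<forall>\<^sub>F w in at v. ereal c < R w"
    by (rule less_LiminfD)
  with c show ?thesis
    unfolding eventually_nhds_conv_at by blast
qed

text \<open>Existence of a minimiser rests on closed sublevel sets. Adding the continuous quadratic term of the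
  proximal objective keeps them closed.\<close>
lemma lsc_plus_continuous_sublevel_closed:
  fixes q :: "'a::topological_space \<Rightarrow> real"
  assumes lsc: "lsc_fun R" and q: "continuous_on UNIV q"
  shows "closed {v. R v + ereal (q v) \<le> ereal c}"
proof -
  have "open {v. ereal c < R v + ereal (q v)}"
    unfolding open_subopen[of "{v. ereal c < R v + ereal (q v)}"]
  proof (intro ballI)
    fix v assume "v \<in> {v. ereal c < R v + ereal (q v)}"
    then have v: "ereal (c - q v) < R v"
      by (cases "R v") auto
    \<comment> \<open>A level strictly between leaves room for \<open>q\<close> to vary.\<close>
    then obtain d where d: "ereal (c - q v) < ereal d" "ereal d < R v"
      using ereal_dense2 by blast
    have "\<forall>\<^sub>F w in nhds v. ereal d < R w"
      by (rule lsc_eventually_gt[OF lsc d(2)])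
    moreover have "\<forall>\<^sub>F w in nhds v. q w > c - d"
    proof -
      have "(q \<longlongrightarrow> q v) (nhds v)"
        using q by (metis UNIV_I continuous_on_def open_UNIV tendsto_at_iff_tendsto_nhds at_within_open)
      then show ?thesis
        using d(1) by (intro order_tendstoD(1)) auto
    qed
    ultimately have "\<forall>\<^sub>F w in nhds v. ereal c < R w + ereal (q w)"
    proof eventually_elim
      case (elim w) then show ?case by (cases "R w") auto
    qed
    then show "\<exists>T. open T \<and> v \<in> T \<and> T \<subseteq> {v. ereal c < R v + ereal (q v)}"
      unfolding eventually_nhds by blast
  qed
  moreover have "{v. R v + ereal (q v) \<le> ereal c} = - {v. ereal c < R v + ereal (q v)}"
    by auto
  ultimately show ?thesis by (simp add: closed_def)
qed

text \<open>The sublevel sets at the levels \<open>m + 1 / n\<close>, where \<open>m\<close> is the infimum, are compact, nonempty and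
  nested. A point common to all of them attains \<open>m\<close>.\<close>
lemma attains_min_of_compact_sublevels:
  fixes f :: "'a::euclidean_space \<Rightarrow> ereal"
  assumes lower: "\<And>v. ereal L \<le> f v" and fin: "f v0 \<noteq> \<infinity>"
    and comp: "\<And>c. compact {v. f v \<le> ereal c}"
  shows "\<exists>u. \<forall>v. f u \<le> f v"
proof -
  have "ereal L \<le> (INF v. f v)" by (simp add: INF_greatest lower)
  moreover have "(INF v. f v) \<le> f v0" by (simp add: INF_lower)
  ultimately obtain m where m: "(INF v. f v) = ereal m"
    using fin by (cases "INF v. f v") auto
  define S where "S n = {v. f v \<le> ereal (m + 1 / Suc n)}" for n :: nat
  have "\<Inter> (range S) \<noteq> {}"
  proof (rule compact_nest)
    fix n :: nat
    have "(INF v. f v) < ereal (m + 1 / Suc n)" by (simp add: m)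
    then obtain v where "f v < ereal (m + 1 / Suc n)"
      unfolding INF_less_iff by blast
    then have "v \<in> S n" by (simp add: S_def less_imp_le)
    moreover have "compact (S n)" unfolding S_def by (rule comp)
    ultimately show "compact (S n)" "S n \<noteq> {}" by auto
  next
    fix n k :: nat assume "k \<le> n"
    then have "m + 1 / Suc n \<le> m + 1 / Suc k" by (simp add: field_simps)
    then show "S n \<subseteq> S k" unfolding S_def
      by (auto intro: order_trans)
  qed
  then obtain u where u: "\<And>n. f u \<le> ereal (m + 1 / Suc n)"
    unfolding S_def by auto
  obtain fu where fu: "f u = ereal fu"
    using u[of 0] lower[of u] by (cases "f u") auto
  have "fu \<le> m"
  proof (rule field_le_epsilon)
    fix e :: real assume "0 < e"
    then obtain n where "1 / Suc n < e" using nat_approx_posE by metis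
    then show "fu \<le> m + e" using u[of n] by (simp add: fu)
  qed
  then have "f u \<le> ereal m" by (simp add: fu)
  then show ?thesis
    by (metis INF_lower UNIV_I m order_trans)
qed

section \<open>Proximal points and the subdifferential\<close>

text \<open>The relation \<open>u = (id + a \<partial>R)\<^sup>-\<^sup>1 y\<close>: the vector \<open>(y - u) / a\<close> is a subgradient of \<open>R\<close> at a
  point \<open>u\<close> of the domain. The analysis uses proximal points only through this inequality, which at
  \<open>xs\<close> is the variational inequality itself.\<close>

definition resolvent_point :: "real \<Rightarrow> ('a::real_inner \<Rightarrow> ereal) \<Rightarrow> 'a \<Rightarrow> 'a \<Rightarrow> bool" where
  "resolvent_point a R y u \<longleftrightarrow>
     \<bar>R u\<bar> \<noteq> \<infinity> \<and> (\<forall>v. R u + ereal ((y - u) \<bullet> (v - u) / a) \<le> R v)"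

text \<open>Monotonicity of the subdifferential: add the subgradient inequality at \<open>u\<close>, tested with \<open>u'\<close>, to
  the one at \<open>u'\<close>, tested with \<open>u\<close>. The values of \<open>R\<close> cancel because they are finite.\<close>
lemma resolvent_firmly_nonexpansive:
  assumes u: "resolvent_point a R y u" and u': "resolvent_point a R y' u'" and a: "a > 0"
  shows "(norm (u - u'))\<^sup>2 \<le> (y - y') \<bullet> (u - u')"
proof -
  obtain r r' where r: "R u = ereal r" "R u' = ereal r'"
    using u u' unfolding resolvent_point_def by (metis ereal_real)
  have "r + (y - u) \<bullet> (u' - u) / a \<le> r'" "r' + (y' - u') \<bullet> (u - u') / a \<le> r"
    using u u' r unfolding resolvent_point_def by (metis ereal_less_eq(3) plus_ereal.simps(1))+
  then have "((y - u) \<bullet> (u' - u) + (y' - u') \<bullet> (u - u')) / a \<le> 0"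
    by (simp add: add_divide_distrib)
  then have "(y - u) \<bullet> (u' - u) + (y' - u') \<bullet> (u - u') \<le> 0"
    using a by (simp add: divide_le_0_iff)
  then show ?thesis
    by (simp add: power2_norm_eq_inner inner_diff_left inner_diff_right inner_commute)
qed

text \<open>The form of firm nonexpansiveness that also controls the residuals \<open>y - u\<close>. In the method the
  residual of a proximal step is a multiple of the new control variate \<open>h\<close>, so one inequality
  bounds both distances in the Lyapunov function.\<close>
lemma resolvent_residual_inequality:
  assumes "resolvent_point a R y u" "resolvent_point a R y' u'" "a > 0"
  shows "(norm (u - u'))\<^sup>2 + (norm ((y - u) - (y' - u')))\<^sup>2 \<le> (norm (y - y'))\<^sup>2"
  using resolvent_firmly_nonexpansive[OF assms]
  by (simp add: power2_norm_eq_inner inner_diff_left inner_diff_right inner_commute)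

text \<open>Comparing \<open>u\<close> with the point \<open>u + t (v - u)\<close>, convexity bounds \<open>R\<close> there to first order in \<open>t\<close>, while
  the quadratic term changes by its derivative plus \<open>O(t\<^sup>2)\<close>. Dividing by \<open>t\<close> and letting \<open>t\<close> tend
  to \<open>0\<close> leaves the subgradient inequality.\<close>
lemma minimizer_imp_resolvent_point:
  assumes conv: "convex_fun R" and proper: "proper_fun R" and a: "a > 0"
    and min: "\<And>v. R u + ereal (1 / (2 * a) * (norm (u - y))\<^sup>2)
                 \<le> R v + ereal (1 / (2 * a) * (norm (v - y))\<^sup>2)"
  shows "resolvent_point a R y u"
proof -
  obtain v0 where v0: "R v0 \<noteq> \<infinity>" using proper unfolding proper_fun_def by blast
  have noninf: "R v \<noteq> -\<infinity>" for v using proper unfolding proper_fun_def by blast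
  obtain r where r: "R u = ereal r"
    using min[of v0] v0 noninf[of u] noninf[of v0] by (cases "R u"; cases "R v0") auto
  have "ereal (r + (y - u) \<bullet> (v - u) / a) \<le> R v" for v
  proof (cases "R v")
    case (real s)
    have key: "r + (y - u) \<bullet> (v - u) / a \<le> s + t * ((norm (v - u))\<^sup>2 / (2 * a))"
      if t: "0 < t" "t < 1" for t
    proof -
      define w where "w = (1 - t) *\<^sub>R u + t *\<^sub>R v"
      have "R w \<le> ereal (1 - t) * R u + ereal t * R v"
        using conv t unfolding convex_fun_def w_def by blast
      then have Rw: "R w \<le> ereal ((1 - t) * r + t * s)" by (simp add: r real)
      then obtain rw where rw: "R w = ereal rw" using noninf[of w] by (cases "R w") auto
      have "r + 1 / (2 * a) * (norm (u - y))\<^sup>2 \<le> rw + 1 / (2 * a) * (norm (w - y))\<^sup>2"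
        using min[of w] r rw by simp
      moreover have "rw \<le> (1 - t) * r + t * s" using Rw rw by simp
      moreover have "(norm (w - y))\<^sup>2
          = (norm (u - y))\<^sup>2 - 2 * t * ((y - u) \<bullet> (v - u)) + t\<^sup>2 * (norm (v - u))\<^sup>2"
      proof -
        have w: "w - y = (u - y) + t *\<^sub>R (v - u)" unfolding w_def by (simp add: algebra_simps)
        show ?thesis unfolding w power2_norm_eq_inner
          by (simp add: inner_simps algebra_simps inner_commute power2_eq_square)
      qed
      ultimately have "r \<le> (1 - t) * r + t * s
          + 1 / (2 * a) * (- 2 * t * ((y - u) \<bullet> (v - u)) + t\<^sup>2 * (norm (v - u))\<^sup>2)"
        by (simp add: algebra_simps add_divide_distrib diff_divide_distrib)
      moreover have e: "1 / (2 * a) * (- 2 * t * ((y - u) \<bullet> (v - u)) + t\<^sup>2 * (norm (v - u))\<^sup>2)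
          = t * (t * ((norm (v - u))\<^sup>2 / (2 * a))) - t * ((y - u) \<bullet> (v - u) / a)"
        using a by (simp add: field_simps power2_eq_square)
      ultimately have "t * (r + (y - u) \<bullet> (v - u) / a) \<le> t * (s + t * ((norm (v - u))\<^sup>2 / (2 * a)))"
        unfolding e by (simp add: algebra_simps)
      then show ?thesis using t by simp
    qed
    have "r + (y - u) \<bullet> (v - u) / a \<le> s"
    proof (rule tendsto_lowerbound)
      show "((\<lambda>t. s + t * ((norm (v - u))\<^sup>2 / (2 * a))) \<longlongrightarrow> s) (at_right 0)"
        using a by (auto intro!: tendsto_eq_intros)
      show "\<forall>\<^sub>F t in at_right 0. r + (y - u) \<bullet> (v - u) / a \<le> s + t * ((norm (v - u))\<^sup>2 / (2 * a))"
        using eventually_at_right_real[OF zero_less_one]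
        by eventually_elim (use key in auto)
    qed simp
    then show ?thesis by (simp add: real)
  qed (use noninf in auto)
  then show ?thesis unfolding resolvent_point_def by (simp add: r)
qed

text \<open>Completing the square spends half of the quadratic on absorbing the linear term. The other half
  keeps the sublevel sets of the proximal objective bounded.\<close>
lemma coercive_prox_objective:
  fixes b v y :: "'a::real_inner"
  assumes a: "a > 0"
  shows "b \<bullet> y - a * (norm b)\<^sup>2 + 1 / (4 * a) * (norm (v - y))\<^sup>2
     \<le> b \<bullet> v + 1 / (2 * a) * (norm (v - y))\<^sup>2"
proof -
  have "0 \<le> (norm ((v - y) + (2 * a) *\<^sub>R b))\<^sup>2 / (4 * a)" using a by simp
  also have "(norm ((v - y) + (2 * a) *\<^sub>R b))\<^sup>2
      = (norm (v - y))\<^sup>2 + 4 * a * (b \<bullet> (v - y)) + 4 * a\<^sup>2 * (norm b)\<^sup>2"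
    unfolding power2_norm_eq_inner by (simp add: inner_simps algebra_simps inner_commute power2_eq_square)
  also have "\<dots> / (4 * a) = 1 / (4 * a) * (norm (v - y))\<^sup>2 + b \<bullet> (v - y) + a * (norm b)\<^sup>2"
    using a by (simp add: field_simps power2_eq_square)
  finally have "0 \<le> 1 / (4 * a) * (norm (v - y))\<^sup>2 + b \<bullet> v - b \<bullet> y + a * (norm b)\<^sup>2"
    by (simp add: inner_diff_right)
  moreover have "1 / (2 * a) * (norm (v - y))\<^sup>2 = 2 * (1 / (4 * a) * (norm (v - y))\<^sup>2)"
    by simp
  ultimately show ?thesis by linarith
qed

text \<open>The operator \<^const>\<open>prox\<close> chooses some minimiser, so the work lies in showing that one exists. An
  affine minorant of \<open>R\<close> makes the objective coercive, hence its sublevel sets compact.\<close>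
lemma prox_resolvent_point:
  fixes R :: "'a::euclidean_space \<Rightarrow> ereal"
  assumes proper: "proper_fun R" and lsc: "lsc_fun R" and conv: "convex_fun R" and a: "a > 0"
    and minorant: "\<And>v. ereal (m + b \<bullet> v) \<le> R v"
  shows "resolvent_point a R y (prox a R y)"
proof -
  define q where "q v = 1 / (2 * a) * (norm (v - y))\<^sup>2" for v
  define f where "f v = R v + ereal (q v)" for v
  obtain v0 where v0: "R v0 \<noteq> \<infinity>" using proper unfolding proper_fun_def by blast
  define L where "L = m + b \<bullet> y - a * (norm b)\<^sup>2"
  have low: "ereal (L + 1 / (4 * a) * (norm (v - y))\<^sup>2) \<le> f v" for v
  proof -
    have "L + 1 / (4 * a) * (norm (v - y))\<^sup>2 \<le> (m + b \<bullet> v) + q v"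
      using coercive_prox_objective[OF a, of b y v] unfolding L_def q_def by simp
    then have "ereal (L + 1 / (4 * a) * (norm (v - y))\<^sup>2) \<le> ereal (m + b \<bullet> v) + ereal (q v)"
      by simp
    also have "\<dots> \<le> f v" unfolding f_def by (intro add_right_mono minorant)
    finally show ?thesis .
  qed
  have "\<exists>u. \<forall>v. f u \<le> f v"
  proof (rule attains_min_of_compact_sublevels)
    show "ereal L \<le> f v" for v
      by (rule order_trans[OF _ low]) (use a in auto)
    show "f v0 \<noteq> \<infinity>" using v0 unfolding f_def by simp
    fix c
    have "closed {v. f v \<le> ereal c}"
      unfolding f_def by (rule lsc_plus_continuous_sublevel_closed[OF lsc])
        (use a in \<open>auto simp: q_def intro!: continuous_intros\<close>)
    moreover have "bounded {v. f v \<le> ereal c}"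
    proof (rule bounded_subset[OF bounded_cball])
      show "{v. f v \<le> ereal c} \<subseteq> cball y (sqrt (4 * a * (c - L)))"
      proof
        fix v assume "v \<in> {v. f v \<le> ereal c}"
        then have "ereal (L + 1 / (4 * a) * (norm (v - y))\<^sup>2) \<le> ereal c"
          using low[of v] by (metis mem_Collect_eq order_trans)
        then have "(norm (v - y))\<^sup>2 / (4 * a) \<le> c - L" by simp
        then have "(norm (v - y))\<^sup>2 \<le> 4 * a * (c - L)"
          using a by (simp add: pos_divide_le_eq mult.commute)
        then show "v \<in> cball y (sqrt (4 * a * (c - L)))"
          by (simp add: dist_norm norm_minus_commute real_le_rsqrt)
      qed
    qed
    ultimately show "compact {v. f v \<le> ereal c}" by (simp add: compact_eq_bounded_closed)
  qed
  then obtain u where "is_arg_min f (\<lambda>_. True) u"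
    by (auto simp: is_arg_min_linorder)
  then have "is_arg_min f (\<lambda>_. True) (prox a R y)"
    unfolding prox_def arg_min_def f_def q_def by (rule someI)
  then have "\<And>v. f (prox a R y) \<le> f v"
    by (simp add: is_arg_min_linorder)
  then show ?thesis
    unfolding f_def q_def by (rule minimizer_imp_resolvent_point[OF conv proper a])
qed

lemma vi_solution_finite:
  assumes proper: "proper_fun R" and vi: "vi_solution F R xs"
  shows "\<bar>R xs\<bar> \<noteq> \<infinity>"
proof -
  obtain v0 where v0: "R v0 \<noteq> \<infinity>" "R v0 \<noteq> -\<infinity>" using proper unfolding proper_fun_def by blast
  have "ereal (F xs \<bullet> (v0 - xs)) + R v0 - R xs \<ge> 0" using vi unfolding vi_solution_def by blast
  moreover have "R xs \<noteq> -\<infinity>" using proper unfolding proper_fun_def by blast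
  ultimately show ?thesis using v0 by (cases "R xs"; cases "R v0") auto
qed

text \<open>The variational inequality says that \<open>- F xs\<close> is a subgradient of \<open>R\<close> at \<open>xs\<close>. This is both the affine
  minorant that makes proximal points exist and the optimality condition at \<open>xs\<close>.\<close>
lemma vi_solution_minorant:
  assumes proper: "proper_fun R" and vi: "vi_solution F R xs"
  shows "R xs + ereal (- (F xs \<bullet> (v - xs))) \<le> R v"
proof -
  have "ereal (F xs \<bullet> (v - xs)) + R v - R xs \<ge> 0" using vi unfolding vi_solution_def by blast
  then show ?thesis using vi_solution_finite[OF assms] by (cases "R xs"; cases "R v") auto
qed

text \<open>The fixed point of the proximal step: at \<open>xs\<close> the ideal control variate is \<open>F xs\<close>.\<close>
lemma vi_solution_resolvent_point:
  assumes proper: "proper_fun R" and vi: "vi_solution F R xs" and a: "a > 0"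
  shows "resolvent_point a R (xs - a *\<^sub>R F xs) xs"
  using vi_solution_minorant[OF proper vi] vi_solution_finite[OF proper vi] a
  by (simp add: resolvent_point_def)

lemma prox_resolvent_point_vi:
  fixes R :: "'a::euclidean_space \<Rightarrow> ereal"
  assumes "proper_fun R" "lsc_fun R" "convex_fun R" "vi_solution F R xs" "a > 0"
  shows "resolvent_point a R y (prox a R y)"
proof -
  obtain r where r: "R xs = ereal r"
    using vi_solution_finite[OF assms(1,4)] by (metis ereal_real)
  have "ereal ((r + F xs \<bullet> xs) + (- F xs) \<bullet> v) \<le> R v" for v
    using vi_solution_minorant[OF assms(1,4), of v] by (simp add: r inner_diff_right algebra_simps)
  then show ?thesis
    by (rule prox_resolvent_point[OF assms(1-3,5)])
qed

text \<open>The iterates are random variables only if the proximal operator is measurable. Nonexpansiveness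
  gives continuity, whichever selection \<open>T\<close> is used.\<close>
lemma resolvent_selection_continuous:
  assumes T: "\<And>y. resolvent_point a R y (T y)" and a: "a > 0"
  shows "continuous_on UNIV T"
proof -
  have "norm (T y - T z) \<le> norm (y - z)" for y z
  proof -
    have "(norm (T y - T z))\<^sup>2 \<le> (norm (y - z))\<^sup>2"
      using resolvent_residual_inequality[OF T T a, of y z] by (smt (verit) zero_le_power2)
    then show ?thesis by (simp add: power2_le_iff_abs_le)
  qed
  then show ?thesis
    unfolding continuous_on_iff dist_norm by (meson le_less_trans)
qed

section \<open>One step along a single run\<close>

text \<open>When the coin asks for the proximal step, apply the residual inequality to the pair
  \<open>xh - (\<gamma> / p) h\<close> and \<open>xs - (\<gamma> / p) hs\<close>. By the update rule the residual is \<open>- (\<gamma> / p) h'\<close>, and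
  expanding the square on the right produces the cross term. When the step is skipped both sides
  agree. Writing the coin as a factor \<open>0\<close> or \<open>1\<close> isolates the only term whose expectation needs
  independence.\<close>

lemma proxskip_step_decrease:
  fixes x h x' h' g hs xs :: "'a::real_inner" and \<gamma> p :: real
  defines "xh \<equiv> x - \<gamma> *\<^sub>R (g - h)"
  assumes p: "p > 0" and \<gamma>: "\<gamma> > 0"
    and T: "\<And>y. resolvent_point (\<gamma> / p) R y (T y)"
    and xs: "resolvent_point (\<gamma> / p) R (xs - (\<gamma> / p) *\<^sub>R hs) xs"
    and x': "x' = (if flip then T (xh - (\<gamma> / p) *\<^sub>R h) else xh)"
    and h': "h' = h + (p / \<gamma>) *\<^sub>R (x' - xh)"
  shows "(norm (x' - xs))\<^sup>2 + \<gamma>\<^sup>2 / p\<^sup>2 * (norm (h' - hs))\<^sup>2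
     \<le> (norm (xh - xs))\<^sup>2 + \<gamma>\<^sup>2 / p\<^sup>2 * (norm (h - hs))\<^sup>2
        - of_bool flip * (2 * (\<gamma> / p) * ((xh - xs) \<bullet> (h - hs)))"
proof (cases flip)
  case True
  define y where "y = xh - (\<gamma> / p) *\<^sub>R h"
  define a where "a = \<gamma> / p"
  have a: "a > 0" using p \<gamma> by (simp add: a_def)
  have xy: "x' = T y" using True x' by (simp add: y_def)
  have "(norm (x' - xs))\<^sup>2 + (norm ((y - x') - (xs - a *\<^sub>R hs - xs)))\<^sup>2
      \<le> (norm (y - (xs - a *\<^sub>R hs)))\<^sup>2"
    using resolvent_residual_inequality[OF T xs, of y] a xy by (simp add: a_def)
  moreover have "(y - x') - (xs - a *\<^sub>R hs - xs) = - (a *\<^sub>R (h' - hs))"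
    using p \<gamma> unfolding h' y_def a_def by (simp add: algebra_simps)
  moreover have "y - (xs - a *\<^sub>R hs) = (xh - xs) - a *\<^sub>R (h - hs)"
    unfolding y_def a_def by (simp add: algebra_simps)
  moreover have "(norm ((xh - xs) - a *\<^sub>R (h - hs)))\<^sup>2
      = (norm (xh - xs))\<^sup>2 + a\<^sup>2 * (norm (h - hs))\<^sup>2 - 2 * a * ((xh - xs) \<bullet> (h - hs))"
    unfolding power2_norm_eq_inner
    by (simp add: inner_diff_left inner_diff_right inner_commute power2_eq_square algebra_simps)
  ultimately have "(norm (x' - xs))\<^sup>2 + a\<^sup>2 * (norm (h' - hs))\<^sup>2
      \<le> (norm (xh - xs))\<^sup>2 + a\<^sup>2 * (norm (h - hs))\<^sup>2 - 2 * a * ((xh - xs) \<bullet> (h - hs))"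
    by (simp only: norm_minus_cancel norm_scaleR power_mult_distrib power2_abs)
  then show ?thesis
    using True by (simp add: a_def power_divide)
qed (use x' h' in simp)

text \<open>After averaging over the coin the factors \<open>p\<close> and \<open>1 / p\<close> cancel, and the cross term completes the
  square of \<open>xh - xs - \<gamma> (h - hs) = x - xs - \<gamma> (g - hs)\<close>, in which \<open>h\<close> no longer occurs. What is
  subtracted to complete it, \<open>\<gamma>\<^sup>2\<close> times the squared error of \<open>h\<close>, is the fraction \<open>p\<^sup>2\<close> of the
  control variate term.\<close>
lemma proxskip_coin_average:
  fixes x h g hs xs :: "'a::real_inner" and \<gamma> p :: real
  defines "xh \<equiv> x - \<gamma> *\<^sub>R (g - h)"
  assumes p: "p > 0"
  shows "(norm (xh - xs))\<^sup>2 + \<gamma>\<^sup>2 / p\<^sup>2 * (norm (h - hs))\<^sup>2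
      - p * (2 * (\<gamma> / p) * ((xh - xs) \<bullet> (h - hs)))
    = (norm (x - xs))\<^sup>2 - 2 * \<gamma> * ((g - hs) \<bullet> (x - xs)) + \<gamma>\<^sup>2 * (norm (g - hs))\<^sup>2
      + (1 - p\<^sup>2) * (\<gamma>\<^sup>2 / p\<^sup>2 * (norm (h - hs))\<^sup>2)"
proof -
  have xh: "xh - xs = (x - xs) - \<gamma> *\<^sub>R (g - hs) + \<gamma> *\<^sub>R (h - hs)"
    by (simp add: xh_def algebra_simps)
  have 1: "(norm (xh - xs))\<^sup>2 - 2 * \<gamma> * ((xh - xs) \<bullet> (h - hs))
     = (norm (x - xs))\<^sup>2 - 2 * \<gamma> * ((g - hs) \<bullet> (x - xs)) + \<gamma>\<^sup>2 * (norm (g - hs))\<^sup>2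
       - \<gamma>\<^sup>2 * (norm (h - hs))\<^sup>2"
    unfolding xh power2_norm_eq_inner
    by (simp only: inner_simps inner_commute[of "g - hs"] inner_commute[of "h - hs" "x - xs"])
       (simp add: algebra_simps power2_eq_square inner_commute)
  have 2: "(1 - p\<^sup>2) * (\<gamma>\<^sup>2 / p\<^sup>2 * (norm (h - hs))\<^sup>2)
      = \<gamma>\<^sup>2 / p\<^sup>2 * (norm (h - hs))\<^sup>2 - \<gamma>\<^sup>2 * (norm (h - hs))\<^sup>2"
    using p by (simp add: left_diff_distrib diff_divide_distrib)
  have 3: "p * (2 * (\<gamma> / p) * ((xh - xs) \<bullet> (h - hs))) = 2 * \<gamma> * ((xh - xs) \<bullet> (h - hs))"
    using p by simp
  show ?thesis using 1 2 3 by linarith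
qed

section \<open>Square-integrable random vectors\<close>

definition square_integrable :: "'w measure \<Rightarrow> ('w \<Rightarrow> 'a::euclidean_space) \<Rightarrow> bool" where
  "square_integrable P Y \<longleftrightarrow> Y \<in> borel_measurable P \<and> integrable P (\<lambda>\<omega>. (norm (Y \<omega>))\<^sup>2)"

lemma square_integrable_dominated:
  assumes Y: "Y \<in> borel_measurable P" and Z: "integrable P Z"
    and le: "AE \<omega> in P. (norm (Y \<omega>))\<^sup>2 \<le> Z \<omega>"
  shows "square_integrable P Y"
  unfolding square_integrable_def
proof
  show "integrable P (\<lambda>\<omega>. (norm (Y \<omega>))\<^sup>2)"
    by (rule Bochner_Integration.integrable_bound[OF Z]) (use Y le in auto)
qed (rule Y)

lemma square_integrable_inner:
  assumes "square_integrable P Y" "square_integrable P Z"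
  shows "integrable P (\<lambda>\<omega>. Y \<omega> \<bullet> Z \<omega>)"
proof (rule Bochner_Integration.integrable_bound)
  show "integrable P (\<lambda>\<omega>. (norm (Y \<omega>))\<^sup>2 + (norm (Z \<omega>))\<^sup>2)"
    using assms unfolding square_integrable_def by simp
  show "AE \<omega> in P. norm (Y \<omega> \<bullet> Z \<omega>) \<le> norm ((norm (Y \<omega>))\<^sup>2 + (norm (Z \<omega>))\<^sup>2)"
  proof (rule AE_I2)
    fix \<omega>
    have "\<bar>Y \<omega> \<bullet> Z \<omega>\<bar> \<le> norm (Y \<omega>) * norm (Z \<omega>)" by (rule Cauchy_Schwarz_ineq2)
    also have "\<dots> \<le> (norm (Y \<omega>))\<^sup>2 + (norm (Z \<omega>))\<^sup>2"
      using sum_squares_bound[of "norm (Y \<omega>)" "norm (Z \<omega>)"]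
        mult_nonneg_nonneg[OF norm_ge_zero[of "Y \<omega>"] norm_ge_zero[of "Z \<omega>"]] by linarith
    finally show "norm (Y \<omega> \<bullet> Z \<omega>) \<le> norm ((norm (Y \<omega>))\<^sup>2 + (norm (Z \<omega>))\<^sup>2)" by simp
  qed
qed (use assms in \<open>auto simp: square_integrable_def\<close>)

lemma square_integrable_add:
  assumes "square_integrable P Y" "square_integrable P Z"
  shows "square_integrable P (\<lambda>\<omega>. Y \<omega> + Z \<omega>)"
proof -
  have "integrable P (\<lambda>\<omega>. (norm (Y \<omega>))\<^sup>2 + 2 * (Y \<omega> \<bullet> Z \<omega>) + (norm (Z \<omega>))\<^sup>2)"
    using assms square_integrable_inner[OF assms] unfolding square_integrable_def by simp
  moreover have "(norm (Y \<omega> + Z \<omega>))\<^sup>2 = (norm (Y \<omega>))\<^sup>2 + 2 * (Y \<omega> \<bullet> Z \<omega>) + (norm (Z \<omega>))\<^sup>2" for \<omega>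
    by (simp add: power2_norm_eq_inner inner_simps inner_commute)
  ultimately show ?thesis using assms unfolding square_integrable_def by auto
qed

lemma square_integrable_scaleR:
  "square_integrable P Y \<Longrightarrow> square_integrable P (\<lambda>\<omega>. c *\<^sub>R Y \<omega>)"
  unfolding square_integrable_def by (auto simp: power_mult_distrib)

lemma square_integrable_diff:
  assumes "square_integrable P Y" "square_integrable P Z"
  shows "square_integrable P (\<lambda>\<omega>. Y \<omega> - Z \<omega>)"
  using square_integrable_add[OF assms(1) square_integrable_scaleR[OF assms(2), of "-1"]] by simp

lemma square_integrable_deterministic:
  assumes P: "prob_space P" and Y: "\<And>\<omega>. \<omega> \<in> space P \<Longrightarrow> Y \<omega> = c"
  shows "square_integrable P Y"
proof -
  interpret prob_space P by (rule P)
  show ?thesis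
    unfolding square_integrable_def
    using Y measurable_cong[of P Y "\<lambda>_. c" borel]
      Bochner_Integration.integrable_cong[of P P "\<lambda>\<omega>. (norm (Y \<omega>))\<^sup>2" "\<lambda>_. (norm c)\<^sup>2"] by simp
qed

section \<open>Conditional expectations and independence\<close>

lemma sigma_finite_subalgebra_of_prob_space:
  assumes "prob_space P" "subalgebra P G"
  shows "sigma_finite_subalgebra P G"
  using assms
  by (intro finite_measure_subalgebra_is_sigma_finite)
    (simp add: finite_measure_subalgebra_def finite_measure_subalgebra_axioms_def prob_space_def)

text \<open>The bound on the \<open>[0, \<infinity>]\<close>-valued conditional expectation yields integrability of \<open>f\<close> as well as the
  inequality of means, so that finiteness of second moments passes from each step to the next.\<close>
lemma conditional_bound_imp_expectation_bound:
  fixes f b :: "'w \<Rightarrow> real"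
  assumes P: "prob_space P" and G: "subalgebra P G"
    and f: "f \<in> borel_measurable P" and f0: "\<And>\<omega>. 0 \<le> f \<omega>"
    and b: "integrable P b" and b0: "AE \<omega> in P. 0 \<le> b \<omega>"
    and le: "AE \<omega> in P. nn_cond_exp P G (\<lambda>\<omega>. ennreal (f \<omega>)) \<omega> \<le> ennreal (b \<omega>)"
  shows "integrable P f" and "(\<integral>\<omega>. f \<omega> \<partial>P) \<le> (\<integral>\<omega>. b \<omega> \<partial>P)"
proof -
  interpret sigma_finite_subalgebra P G
    by (rule sigma_finite_subalgebra_of_prob_space[OF P G])
  have "(\<integral>\<^sup>+\<omega>. ennreal (f \<omega>) \<partial>P) = (\<integral>\<^sup>+\<omega>. nn_cond_exp P G (\<lambda>\<omega>. ennreal (f \<omega>)) \<omega> \<partial>P)"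
    using nn_cond_exp_intg[of "\<lambda>_. 1" "\<lambda>\<omega>. ennreal (f \<omega>)"] f by simp
  also have "\<dots> \<le> (\<integral>\<^sup>+\<omega>. ennreal (b \<omega>) \<partial>P)" by (rule nn_integral_mono_AE[OF le])
  also have "\<dots> = ennreal (\<integral>\<omega>. b \<omega> \<partial>P)" by (rule nn_integral_eq_integral[OF b b0])
  finally have bound: "(\<integral>\<^sup>+\<omega>. ennreal (f \<omega>) \<partial>P) \<le> ennreal (\<integral>\<omega>. b \<omega> \<partial>P)" .
  have "(\<integral>\<^sup>+\<omega>. ennreal (f \<omega>) \<partial>P) < \<infinity>"
    by (rule le_less_trans[OF bound]) simp
  then show int: "integrable P f"
    using f f0 by (intro integrableI_bounded) auto
  have "ennreal (\<integral>\<omega>. f \<omega> \<partial>P) \<le> ennreal (\<integral>\<omega>. b \<omega> \<partial>P)"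
    using bound nn_integral_eq_integral[OF int] f0 by simp
  then show "(\<integral>\<omega>. f \<omega> \<partial>P) \<le> (\<integral>\<omega>. b \<omega> \<partial>P)"
    using integral_nonneg_AE[OF b0] by (simp add: ennreal_le_iff)
qed

lemma vec_cond_exp_measurable:
  "vec_cond_exp P G g \<in> borel_measurable G"
  unfolding vec_cond_exp_def by measurable

text \<open>The pull-out property for vectors, obtained coordinatewise from the scalar one. It replaces \<open>g\<close> by
  its conditional mean inside the drift term.\<close>
lemma vec_cond_exp_inner:
  assumes P: "prob_space P" and G: "subalgebra P G"
    and X: "X \<in> borel_measurable G" "square_integrable P X"
    and g: "square_integrable P g"
  shows "(\<integral>\<omega>. g \<omega> \<bullet> X \<omega> \<partial>P) = (\<integral>\<omega>. vec_cond_exp P G g \<omega> \<bullet> X \<omega> \<partial>P)"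
proof -
  interpret sigma_finite_subalgebra P G
    by (rule sigma_finite_subalgebra_of_prob_space[OF P G])
  have gm: "g \<in> borel_measurable P" using g by (simp add: square_integrable_def)
  have int: "integrable P (\<lambda>\<omega>. (X \<omega> \<bullet> b) * (g \<omega> \<bullet> b))" if b: "b \<in> Basis" for b
  proof -
    have "square_integrable P (\<lambda>\<omega>. Z \<omega> \<bullet> b)" if "square_integrable P Z" for Z :: "_ \<Rightarrow> 'b"
    proof (rule square_integrable_dominated)
      show "integrable P (\<lambda>\<omega>. (norm (Z \<omega>))\<^sup>2)" "(\<lambda>\<omega>. Z \<omega> \<bullet> b) \<in> borel_measurable P"
        using that by (auto simp: square_integrable_def)
      show "AE \<omega> in P. (norm (Z \<omega> \<bullet> b))\<^sup>2 \<le> (norm (Z \<omega>))\<^sup>2"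
        using Basis_le_norm[OF b] by (auto intro!: AE_I2 simp flip: abs_le_square_iff)
    qed
    from square_integrable_inner[OF this[OF X(2)] this[OF g]] show ?thesis by simp
  qed
  have each: "integrable P (\<lambda>\<omega>. (X \<omega> \<bullet> b) * real_cond_exp P G (\<lambda>\<omega>. g \<omega> \<bullet> b) \<omega>)"
      "(\<integral>\<omega>. (X \<omega> \<bullet> b) * real_cond_exp P G (\<lambda>\<omega>. g \<omega> \<bullet> b) \<omega> \<partial>P)
        = (\<integral>\<omega>. (X \<omega> \<bullet> b) * (g \<omega> \<bullet> b) \<partial>P)" if "b \<in> Basis" for b
    using real_cond_exp_intg[OF int[OF that]] X(1) gm by auto
  have "(\<integral>\<omega>. g \<omega> \<bullet> X \<omega> \<partial>P) = (\<integral>\<omega>. (\<Sum>b\<in>Basis. (X \<omega> \<bullet> b) * (g \<omega> \<bullet> b)) \<partial>P)"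
    by (subst euclidean_inner) (simp add: mult.commute)
  also have "\<dots> = (\<Sum>b\<in>Basis. \<integral>\<omega>. (X \<omega> \<bullet> b) * (g \<omega> \<bullet> b) \<partial>P)"
    using int by (rule Bochner_Integration.integral_sum)
  also have "\<dots> = (\<Sum>b\<in>Basis. \<integral>\<omega>. (X \<omega> \<bullet> b) * real_cond_exp P G (\<lambda>\<omega>. g \<omega> \<bullet> b) \<omega> \<partial>P)"
    by (simp add: each)
  also have "\<dots> = (\<integral>\<omega>. (\<Sum>b\<in>Basis. (X \<omega> \<bullet> b) * real_cond_exp P G (\<lambda>\<omega>. g \<omega> \<bullet> b) \<omega>) \<partial>P)"
    by (rule Bochner_Integration.integral_sum[symmetric]) (rule each)
  also have "\<dots> = (\<integral>\<omega>. vec_cond_exp P G g \<omega> \<bullet> X \<omega> \<partial>P)"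
    unfolding vec_cond_exp_def inner_sum_left inner_scaleR_left
    by (simp add: mult.commute inner_commute)
  finally show ?thesis .
qed

text \<open>The sigma-algebra of which a coin is independent. It must contain the current estimator besides the
  history \<open>G\<close>, because the quantity that the coin multiplies depends on both.\<close>
lemma adjoin_random_variable:
  assumes G: "subalgebra P G" and g: "g \<in> borel_measurable P"
  defines "N \<equiv> sigma (space P) (sets G \<union> {g -` S \<inter> space P | S. S \<in> sets borel})"
  shows "subalgebra P N" and "sets N = sigma_sets (space P) (sets G \<union> {g -` S \<inter> space P | S. S \<in> sets borel})"
    and "subalgebra N G" and "g \<in> borel_measurable N"
proof -
  have gen: "sets G \<union> {g -` S \<inter> space P | S. S \<in> sets borel} \<subseteq> sets P"
    using G measurable_sets[OF g] unfolding subalgebra_def by auto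
  then have pow: "sets G \<union> {g -` S \<inter> space P | S. S \<in> sets borel} \<subseteq> Pow (space P)"
    using sets.space_closed by blast
  have space: "space N = space P" unfolding N_def by (simp add: space_measure_of_conv)
  show sets: "sets N = sigma_sets (space P) (sets G \<union> {g -` S \<inter> space P | S. S \<in> sets borel})"
    unfolding N_def by (rule sets_measure_of[OF pow])
  show "subalgebra P N"
    unfolding subalgebra_def space sets using sets.sigma_sets_subset[OF gen] by simp
  show "subalgebra N G"
    using G unfolding subalgebra_def space sets by (auto intro: sigma_sets.Basic)
  show "g \<in> borel_measurable N"
  proof (rule measurableI)
    fix S :: "'b set" assume "S \<in> sets borel"
    then show "g -` S \<inter> space N \<in> sets N"
      unfolding space sets by (intro sigma_sets.Basic) auto
  qed simp
qed

text \<open>Independence of the generated sigma-algebras is independence of the coin's indicator from \<open>Z\<close>, and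
  the mean of a product of independent integrable variables is the product of the means.\<close>
lemma independent_coin_expectation:
  fixes Z :: "'w \<Rightarrow> real"
  assumes P: "prob_space P"
    and p: "measure P {\<omega> \<in> space P. flip \<omega>} = p"
    and flip: "flip \<in> measurable P (count_space UNIV)"
    and N: "subalgebra P N"
    and ind: "prob_space.indep_set P {flip -` S \<inter> space P | S. S \<in> sets (count_space UNIV)} (sets N)"
    and Z: "Z \<in> borel_measurable N" "integrable P Z"
  shows "integrable P (\<lambda>\<omega>. of_bool (flip \<omega>) * Z \<omega>)"
    and "(\<integral>\<omega>. of_bool (flip \<omega>) * Z \<omega> \<partial>P) = p * (\<integral>\<omega>. Z \<omega> \<partial>P)"
proof -
  interpret prob_space P by (rule P)
  have coin_m: "(\<lambda>\<omega>. of_bool (flip \<omega>) :: real) \<in> borel_measurable P"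
    using flip by measurable
  have Zm: "Z \<in> borel_measurable P" using Z by auto
  have iv: "indep_var borel (\<lambda>\<omega>. of_bool (flip \<omega>) :: real) borel Z"
    unfolding indep_var_eq
  proof (intro conjI)
    have sub1: "{(\<lambda>\<omega>. of_bool (flip \<omega>) :: real) -` A \<inter> space P | A. A \<in> sets borel}
        \<subseteq> {flip -` S \<inter> space P | S. S \<in> sets (count_space UNIV)}"
    proof clarify
      fix A :: "real set"
      show "\<exists>S. (\<lambda>\<omega>. of_bool (flip \<omega>)) -` A \<inter> space P = flip -` S \<inter> space P \<and> S \<in> sets (count_space UNIV)"
        by (rule exI[of _ "of_bool -` A"]) auto
    qed
    have sub2: "{Z -` A \<inter> space P | A. A \<in> sets borel} \<subseteq> sets N"
      using measurable_sets[OF Z(1)] N unfolding subalgebra_def by auto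
    have preimages: "indep_set {(\<lambda>\<omega>. of_bool (flip \<omega>) :: real) -` A \<inter> space P | A. A \<in> sets borel}
        {Z -` A \<inter> space P | A. A \<in> sets borel}"
    proof (rule indep_setI)
      fix a b
      assume "a \<in> {(\<lambda>\<omega>. of_bool (flip \<omega>) :: real) -` A \<inter> space P | A. A \<in> sets borel}"
        and "b \<in> {Z -` A \<inter> space P | A. A \<in> sets borel}"
      then show "prob (a \<inter> b) = prob a * prob b"
        by (intro indep_setD[OF ind] subsetD[OF sub1] subsetD[OF sub2])
    next
      show "{Z -` A \<inter> space P | A. A \<in> sets borel} \<subseteq> events"
        using sub2 N unfolding subalgebra_def by (meson order_trans)
      show "{(\<lambda>\<omega>. of_bool (flip \<omega>) :: real) -` A \<inter> space P | A. A \<in> sets borel} \<subseteq> events"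
        using measurable_sets[OF coin_m] by auto
    qed
    have stable: "Int_stable {Y -` A \<inter> space P | A. A \<in> sets borel}" for Y :: "'w \<Rightarrow> real"
    proof (rule Int_stableI, clarify)
      fix A B :: "real set" assume AB: "A \<in> sets borel" "B \<in> sets borel"
      show "\<exists>C. (Y -` A \<inter> space P) \<inter> (Y -` B \<inter> space P) = Y -` C \<inter> space P \<and> C \<in> sets borel"
        by (rule exI[of _ "A \<inter> B"]) (use AB in auto)
    qed
    show "indep_set
       (sigma_sets (space P) {(\<lambda>\<omega>. of_bool (flip \<omega>) :: real) -` A \<inter> space P | A. A \<in> sets borel})
       (sigma_sets (space P) {Z -` A \<inter> space P | A. A \<in> sets borel})"
      by (rule indep_set_sigma_sets[OF preimages stable stable])
  qed (use coin_m Zm in auto)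
  have set: "{\<omega> \<in> space P. flip \<omega>} \<in> sets P"
    using flip by measurable
  have ind_eq: "(\<lambda>\<omega>. of_bool (flip \<omega>) :: real) \<omega> = indicator {\<omega> \<in> space P. flip \<omega>} \<omega>"
    if "\<omega> \<in> space P" for \<omega>
    using that by (simp add: indicator_def)
  have "(\<integral>\<omega>. of_bool (flip \<omega>) \<partial>P) = (\<integral>\<omega>. indicator {\<omega> \<in> space P. flip \<omega>} \<omega> \<partial>P :: real)"
    by (rule Bochner_Integration.integral_cong[OF refl ind_eq])
  also have "\<dots> = p" using set p by simp
  finally have mean: "(\<integral>\<omega>. of_bool (flip \<omega>) \<partial>P) = p" .
  have int: "integrable P (\<lambda>\<omega>. of_bool (flip \<omega>) :: real)"
    using set by (subst Bochner_Integration.integrable_cong[OF refl ind_eq])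
      (auto simp: integrable_real_indicator less_top[symmetric])
  show "integrable P (\<lambda>\<omega>. of_bool (flip \<omega>) * Z \<omega>)"
    by (rule indep_var_integrable[OF iv int Z(2)])
  show "(\<integral>\<omega>. of_bool (flip \<omega>) * Z \<omega> \<partial>P) = p * (\<integral>\<omega>. Z \<omega> \<partial>P)"
    using indep_var_lebesgue_integral[OF iv int Z(2)] mean by simp
qed

section \<open>The step in expectation\<close>

text \<open>The pathwise bound has an integrable right-hand side, which gives the square-integrability of the
  next iterates. In its integral the coin factor becomes \<open>p\<close>, because the cross term is
  \<open>N\<close>-measurable and the coin is independent of \<open>N\<close>.\<close>

lemma expected_skip_step_decrease:
  fixes x h x' h' g :: "'w \<Rightarrow> 'a::euclidean_space"
  assumes P: "prob_space P" and N: "subalgebra P N"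
    and p: "p > 0" and \<gamma>: "\<gamma> > 0"
    and T: "\<And>y. resolvent_point (\<gamma> / p) R y (T y)"
    and xs: "resolvent_point (\<gamma> / p) R (xs - (\<gamma> / p) *\<^sub>R hs) xs"
    and coin: "measure P {\<omega> \<in> space P. flip \<omega>} = p" "flip \<in> measurable P (count_space UNIV)"
      "prob_space.indep_set P {flip -` S \<inter> space P | S. S \<in> sets (count_space UNIV)} (sets N)"
    and meas: "x \<in> borel_measurable N" "h \<in> borel_measurable N" "g \<in> borel_measurable N"
      "x' \<in> borel_measurable P" "h' \<in> borel_measurable P"
    and sq: "square_integrable P (\<lambda>\<omega>. x \<omega> - xs)" "square_integrable P (\<lambda>\<omega>. h \<omega> - hs)"
      "square_integrable P (\<lambda>\<omega>. g \<omega> - hs)"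
    and x': "\<And>\<omega>. \<omega> \<in> space P \<Longrightarrow> x' \<omega> = (if flip \<omega>
        then T (x \<omega> - \<gamma> *\<^sub>R (g \<omega> - h \<omega>) - (\<gamma> / p) *\<^sub>R h \<omega>) else x \<omega> - \<gamma> *\<^sub>R (g \<omega> - h \<omega>))"
    and h': "\<And>\<omega>. \<omega> \<in> space P \<Longrightarrow>
        h' \<omega> = h \<omega> + (p / \<gamma>) *\<^sub>R (x' \<omega> - (x \<omega> - \<gamma> *\<^sub>R (g \<omega> - h \<omega>)))"
  shows "square_integrable P (\<lambda>\<omega>. x' \<omega> - xs)" (is ?A)
    and "square_integrable P (\<lambda>\<omega>. h' \<omega> - hs)" (is ?B)
    and "(\<integral>\<omega>. (norm (x' \<omega> - xs))\<^sup>2 \<partial>P) + \<gamma>\<^sup>2 / p\<^sup>2 * (\<integral>\<omega>. (norm (h' \<omega> - hs))\<^sup>2 \<partial>P)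
      \<le> (\<integral>\<omega>. (norm (x \<omega> - xs))\<^sup>2 \<partial>P) - 2 * \<gamma> * (\<integral>\<omega>. (g \<omega> - hs) \<bullet> (x \<omega> - xs) \<partial>P)
        + \<gamma>\<^sup>2 * (\<integral>\<omega>. (norm (g \<omega> - hs))\<^sup>2 \<partial>P)
        + (1 - p\<^sup>2) * (\<gamma>\<^sup>2 / p\<^sup>2 * (\<integral>\<omega>. (norm (h \<omega> - hs))\<^sup>2 \<partial>P))" (is ?C)
proof -
  interpret prob_space P by (rule P)
  define xh where "xh \<omega> = x \<omega> - \<gamma> *\<^sub>R (g \<omega> - h \<omega>)" for \<omega>
  define Q where "Q \<omega> = (norm (xh \<omega> - xs))\<^sup>2 + \<gamma>\<^sup>2 / p\<^sup>2 * (norm (h \<omega> - hs))\<^sup>2" for \<omega>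
  define Z where "Z \<omega> = 2 * (\<gamma> / p) * ((xh \<omega> - xs) \<bullet> (h \<omega> - hs))" for \<omega>
  define W where "W \<omega> = Q \<omega> - of_bool (flip \<omega>) * Z \<omega>" for \<omega>
  have "square_integrable P (\<lambda>\<omega>. (x \<omega> - xs) - \<gamma> *\<^sub>R ((g \<omega> - hs) - (h \<omega> - hs)))"
    by (intro square_integrable_diff square_integrable_scaleR sq)
  then have xh_sq: "square_integrable P (\<lambda>\<omega>. xh \<omega> - xs)"
    by (simp add: xh_def algebra_simps)
  have Q_int: "integrable P Q"
    using xh_sq sq(2) unfolding Q_def square_integrable_def by simp
  have Z_int: "integrable P Z"
    unfolding Z_def by (intro integrable_mult_right square_integrable_inner xh_sq sq(2))
  have Z_meas: "Z \<in> borel_measurable N"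
    unfolding Z_def xh_def using meas by measurable
  note coin_Z = independent_coin_expectation[OF P coin(1,2) N coin(3) Z_meas Z_int]
  have W_int: "integrable P W" unfolding W_def using Q_int coin_Z(1) by simp
  have dec: "(norm (x' \<omega> - xs))\<^sup>2 + \<gamma>\<^sup>2 / p\<^sup>2 * (norm (h' \<omega> - hs))\<^sup>2 \<le> W \<omega>"
    if "\<omega> \<in> space P" for \<omega>
    unfolding W_def Q_def Z_def xh_def
    by (rule proxskip_step_decrease[OF p \<gamma> T xs x'[OF that] h'[OF that]])
  show A: ?A
  proof (rule square_integrable_dominated[OF _ W_int])
    show "AE \<omega> in P. (norm (x' \<omega> - xs))\<^sup>2 \<le> W \<omega>"
      by (rule AE_I2, rule order_trans[OF _ dec]) (auto intro: zero_le_power2)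
  qed (use meas in measurable)
  show B: ?B
  proof (rule square_integrable_dominated)
    show "integrable P (\<lambda>\<omega>. p\<^sup>2 / \<gamma>\<^sup>2 * W \<omega>)" using W_int by simp
    show "AE \<omega> in P. (norm (h' \<omega> - hs))\<^sup>2 \<le> p\<^sup>2 / \<gamma>\<^sup>2 * W \<omega>"
    proof (rule AE_I2)
      fix \<omega> assume "\<omega> \<in> space P"
      then have "\<gamma>\<^sup>2 / p\<^sup>2 * (norm (h' \<omega> - hs))\<^sup>2 \<le> W \<omega>"
        using dec[of \<omega>] zero_le_power2[of "norm (x' \<omega> - xs)"] by linarith
      then have "p\<^sup>2 / \<gamma>\<^sup>2 * (\<gamma>\<^sup>2 / p\<^sup>2 * (norm (h' \<omega> - hs))\<^sup>2) \<le> p\<^sup>2 / \<gamma>\<^sup>2 * W \<omega>"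
        by (rule mult_left_mono) simp
      then show "(norm (h' \<omega> - hs))\<^sup>2 \<le> p\<^sup>2 / \<gamma>\<^sup>2 * W \<omega>"
        using p \<gamma> by simp
    qed
  qed (use meas in measurable)
  have ints: "integrable P (\<lambda>\<omega>. (norm (x' \<omega> - xs))\<^sup>2)" "integrable P (\<lambda>\<omega>. (norm (h' \<omega> - hs))\<^sup>2)"
      "integrable P (\<lambda>\<omega>. (norm (x \<omega> - xs))\<^sup>2)" "integrable P (\<lambda>\<omega>. (norm (h \<omega> - hs))\<^sup>2)"
      "integrable P (\<lambda>\<omega>. (norm (g \<omega> - hs))\<^sup>2)" "integrable P (\<lambda>\<omega>. (g \<omega> - hs) \<bullet> (x \<omega> - xs))"
    using A B sq square_integrable_inner[OF sq(3,1)] unfolding square_integrable_def by auto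
  have "(\<integral>\<omega>. (norm (x' \<omega> - xs))\<^sup>2 \<partial>P) + \<gamma>\<^sup>2 / p\<^sup>2 * (\<integral>\<omega>. (norm (h' \<omega> - hs))\<^sup>2 \<partial>P)
      = (\<integral>\<omega>. (norm (x' \<omega> - xs))\<^sup>2 + \<gamma>\<^sup>2 / p\<^sup>2 * (norm (h' \<omega> - hs))\<^sup>2 \<partial>P)"
    by (subst Bochner_Integration.integral_add) (use ints in simp_all)
  also have "\<dots> \<le> (\<integral>\<omega>. W \<omega> \<partial>P)"
    by (rule integral_mono) (use ints W_int dec in auto)
  also have "\<dots> = (\<integral>\<omega>. Q \<omega> \<partial>P) - p * (\<integral>\<omega>. Z \<omega> \<partial>P)"
    unfolding W_def using Q_int coin_Z by simp
  also have "\<dots> = (\<integral>\<omega>. Q \<omega> - p * Z \<omega> \<partial>P)"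
    using Q_int Z_int by simp
  also have "\<dots> = (\<integral>\<omega>. (norm (x \<omega> - xs))\<^sup>2 - 2 * \<gamma> * ((g \<omega> - hs) \<bullet> (x \<omega> - xs))
      + \<gamma>\<^sup>2 * (norm (g \<omega> - hs))\<^sup>2 + (1 - p\<^sup>2) * (\<gamma>\<^sup>2 / p\<^sup>2 * (norm (h \<omega> - hs))\<^sup>2) \<partial>P)"
    unfolding Q_def Z_def xh_def proxskip_coin_average[OF p] ..
  also have "\<dots> = (\<integral>\<omega>. (norm (x \<omega> - xs))\<^sup>2 \<partial>P) - 2 * \<gamma> * (\<integral>\<omega>. (g \<omega> - hs) \<bullet> (x \<omega> - xs) \<partial>P)
        + \<gamma>\<^sup>2 * (\<integral>\<omega>. (norm (g \<omega> - hs))\<^sup>2 \<partial>P)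
        + (1 - p\<^sup>2) * (\<gamma>\<^sup>2 / p\<^sup>2 * (\<integral>\<omega>. (norm (h \<omega> - hs))\<^sup>2 \<partial>P))"
    by (simp only: Bochner_Integration.integral_add Bochner_Integration.integral_diff
        integral_mult_right_zero Bochner_Integration.integrable_add Bochner_Integration.integrable_diff
        integrable_mult_right ints)
  finally show ?C .
qed

text \<open>Cauchy-Schwarz turns star-cocoercivity into a linear growth bound, through which
  square-integrability passes from \<open>x\<close> to \<open>F x\<close>.\<close>
lemma star_cocoercive_imp_lipschitz_at:
  assumes "star_cocoercive l F xs" "l > 0"
  shows "norm (F x - F xs) \<le> l * norm (x - xs)"
proof -
  have "1 / l * (norm (F x - F xs))\<^sup>2 \<le> norm (F x - F xs) * norm (x - xs)"
    using assms(1) norm_cauchy_schwarz[of "F x - F xs" "x - xs"]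
    unfolding star_cocoercive_def by (meson order_trans)
  then have "norm (F x - F xs) * norm (F x - F xs) \<le> norm (F x - F xs) * (l * norm (x - xs))"
    using assms(2) by (simp add: field_simps power2_eq_square)
  then show ?thesis
    using assms(2) by (cases "F x = F xs") auto
qed

text \<open>The operator \<open>F\<close> is an arbitrary function, so \<open>F (x \<omega>)\<close> may fail to be measurable in \<open>\<omega>\<close>. The
  conditional mean of \<open>g\<close> is measurable and agrees with it almost everywhere, and therefore stands in
  for it in all integrals.\<close>
lemma integrable_conditional_drift:
  assumes P: "prob_space P" and G: "subalgebra P G"
    and x: "x \<in> borel_measurable G" "square_integrable P (\<lambda>\<omega>. x \<omega> - xs)"
    and unbiased: "AE \<omega> in P. vec_cond_exp P G g \<omega> = F (x \<omega>)"
    and coco: "star_cocoercive l F xs" "l > 0"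
  shows "integrable P (\<lambda>\<omega>. (vec_cond_exp P G g \<omega> - F xs) \<bullet> (x \<omega> - xs))"
proof -
  have m: "vec_cond_exp P G g \<in> borel_measurable P"
    by (rule measurable_from_subalg[OF G vec_cond_exp_measurable])
  have "square_integrable P (\<lambda>\<omega>. vec_cond_exp P G g \<omega> - F xs)"
  proof (rule square_integrable_dominated)
    show "integrable P (\<lambda>\<omega>. l\<^sup>2 * (norm (x \<omega> - xs))\<^sup>2)"
      using x(2) unfolding square_integrable_def by simp
    show "AE \<omega> in P. (norm (vec_cond_exp P G g \<omega> - F xs))\<^sup>2 \<le> l\<^sup>2 * (norm (x \<omega> - xs))\<^sup>2"
      using unbiased
    proof eventually_elim
      case (elim \<omega>)
      then show ?case
        using star_cocoercive_imp_lipschitz_at[OF coco, of "x \<omega>"]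
        by (metis norm_ge_zero power_mono power_mult_distrib)
    qed
  qed (use m in measurable)
  then show ?thesis by (rule square_integrable_inner[OF _ x(2)])
qed

text \<open>The two moment conditions of the estimator have the same shape. This lemma serves both, with \<open>f\<close>
  the squared error of the estimator or the next squared \<open>\<sigma>\<close>.\<close>
lemma estimator_moments:
  fixes P G :: "'w measure" and g x :: "'w \<Rightarrow> 'a::euclidean_space" and F :: "'a \<Rightarrow> 'a" and xs :: 'a
  defines "J \<equiv> \<lambda>\<omega>. (vec_cond_exp P G g \<omega> - F xs) \<bullet> (x \<omega> - xs)"
  assumes P: "prob_space P" and G: "subalgebra P G"
    and x: "x \<in> borel_measurable G" "square_integrable P (\<lambda>\<omega>. x \<omega> - xs)"
    and unbiased: "AE \<omega> in P. vec_cond_exp P G g \<omega> = F (x \<omega>)"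
    and coco: "star_cocoercive l F xs" "l > 0"
    and s: "square_integrable P s"
    and f: "f \<in> borel_measurable P" "\<And>\<omega>. 0 \<le> f \<omega>"
    and coeffs: "0 \<le> a" "0 \<le> b" "0 \<le> d"
    and bound: "AE \<omega> in P. nn_cond_exp P G (\<lambda>\<omega>. ennreal (f \<omega>)) \<omega>
      \<le> ennreal (2 * a * ((F (x \<omega>) - F xs) \<bullet> (x \<omega> - xs)) + b * (s \<omega>)\<^sup>2 + d)"
  shows "integrable P f"
    and "(\<integral>\<omega>. f \<omega> \<partial>P) \<le> 2 * a * (\<integral>\<omega>. J \<omega> \<partial>P) + b * (\<integral>\<omega>. (s \<omega>)\<^sup>2 \<partial>P) + d"
proof -
  interpret prob_space P by (rule P)
  have J_int: "integrable P (J)"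
    unfolding J_def by (rule integrable_conditional_drift[OF P G x unbiased coco])
  have s_int: "integrable P (\<lambda>\<omega>. (s \<omega>)\<^sup>2)" using s unfolding square_integrable_def by simp
  have b_int: "integrable P (\<lambda>\<omega>. 2 * a * J \<omega> + b * (s \<omega>)\<^sup>2 + d)"
    using J_int s_int by simp
  have nonneg: "AE \<omega> in P. 0 \<le> 2 * a * J \<omega> + b * (s \<omega>)\<^sup>2 + d"
    using unbiased
  proof eventually_elim
    case (elim \<omega>)
    have "0 \<le> 1 / l * (norm (F (x \<omega>) - F xs))\<^sup>2" using coco(2) by simp
    also have "\<dots> \<le> J \<omega>"
      using coco(1) elim unfolding J_def star_cocoercive_def by simp
    finally show ?case using coeffs by simp
  qed
  have le: "AE \<omega> in P. nn_cond_exp P G (\<lambda>\<omega>. ennreal (f \<omega>)) \<omega>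
      \<le> ennreal (2 * a * J \<omega> + b * (s \<omega>)\<^sup>2 + d)"
    using unbiased bound by eventually_elim (simp add: J_def)
  note * = conditional_bound_imp_expectation_bound[OF P G f b_int nonneg le]
  show "integrable P f" by (rule *(1))
  have "(\<integral>\<omega>. 2 * a * J \<omega> + b * (s \<omega>)\<^sup>2 + d \<partial>P)
      = 2 * a * (\<integral>\<omega>. J \<omega> \<partial>P) + b * (\<integral>\<omega>. (s \<omega>)\<^sup>2 \<partial>P) + d"
    using J_int s_int by (simp add: prob_space)
  with *(2) show "(\<integral>\<omega>. f \<omega> \<partial>P) \<le> 2 * a * (\<integral>\<omega>. J \<omega> \<partial>P) + b * (\<integral>\<omega>. (s \<omega>)\<^sup>2 \<partial>P) + d"
    by simp
qed

section \<open>Contraction of the Lyapunov function\<close>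

text \<open>The contraction in terms of the means involved: \<open>X\<close>, \<open>Y\<close> and \<open>S\<close> for the squared distance, the scaled
  squared error of \<open>h\<close> and \<open>\<sigma>\<^sup>2\<close>, \<open>I\<close> for the drift, \<open>V\<close> for the squared error of the estimator, \<open>U\<close> for
  the next value of the first two terms. The step size lets half of the drift \<open>- 2 \<gamma> I\<close> absorb the
  multiples of \<open>I\<close> coming from the two moment bounds. The other half contracts \<open>X\<close> by
  \<open>1 - \<gamma> \<mu>\<close>. The multiples of \<open>S\<close> add up to \<open>B + M (1 - \<rho>) = M (1 - (\<rho> - B / M))\<close>.\<close>

lemma lyapunov_contraction_arith:
  fixes X Y S S' I U V :: real
  assumes U: "U \<le> X - 2 * \<gamma> * I + \<gamma>\<^sup>2 * V + (1 - p\<^sup>2) * Y"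
    and V: "V \<le> 2 * A * I + B * S + D1"
    and S': "S' \<le> 2 * C * I + (1 - \<rho>) * S + D2"
    and I: "\<mu> * X \<le> I"
    and nonneg: "0 \<le> X" "0 \<le> Y" "0 \<le> S" "\<mu> > 0" "\<gamma> > 0" "M > 0"
    and step: "2 * \<gamma> * (A + M * C) \<le> 1"
    and \<tau>: "\<tau> \<le> \<gamma> * \<mu>" "\<tau> \<le> p\<^sup>2" "\<tau> \<le> \<rho> - B / M"
  shows "U + M * \<gamma>\<^sup>2 * S' \<le> (1 - \<tau>) * (X + Y + M * \<gamma>\<^sup>2 * S) + \<gamma>\<^sup>2 * (D1 + M * D2)"
proof -
  have I0: "0 \<le> I" using I nonneg by (meson less_imp_le mult_nonneg_nonneg order_trans)
  have "\<gamma>\<^sup>2 * V \<le> \<gamma>\<^sup>2 * (2 * A * I + B * S + D1)"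
    by (rule mult_left_mono[OF V]) simp
  moreover have "M * \<gamma>\<^sup>2 * S' \<le> M * \<gamma>\<^sup>2 * (2 * C * I + (1 - \<rho>) * S + D2)"
    by (rule mult_left_mono[OF S']) (use nonneg in simp)
  ultimately have "U + M * \<gamma>\<^sup>2 * S' \<le> X - 2 * \<gamma> * I + (2 * \<gamma> * (A + M * C)) * (\<gamma> * I)
      + (1 - p\<^sup>2) * Y + \<gamma>\<^sup>2 * (B + M * (1 - \<rho>)) * S + \<gamma>\<^sup>2 * (D1 + M * D2)"
    using U by (simp add: algebra_simps power2_eq_square)
  moreover have "(2 * \<gamma> * (A + M * C)) * (\<gamma> * I) \<le> 1 * (\<gamma> * I)"
    by (rule mult_right_mono[OF step]) (use nonneg I0 in simp)
  moreover have "\<tau> * X \<le> \<gamma> * I"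
  proof -
    have "\<tau> * X \<le> \<gamma> * \<mu> * X" by (rule mult_right_mono[OF \<tau>(1)]) (rule nonneg)
    also have "\<dots> \<le> \<gamma> * I" using mult_left_mono[OF I, of \<gamma>] nonneg by (simp add: mult.assoc)
    finally show ?thesis .
  qed
  moreover have "\<tau> * Y \<le> p\<^sup>2 * Y" by (rule mult_right_mono[OF \<tau>(2)]) (rule nonneg)
  moreover have "\<gamma>\<^sup>2 * (B + M * (1 - \<rho>)) * S \<le> (1 - \<tau>) * (M * \<gamma>\<^sup>2 * S)"
  proof -
    have "B + M * (1 - \<rho>) = M * (1 - (\<rho> - B / M))" using nonneg by (simp add: field_simps)
    also have "\<dots> \<le> M * (1 - \<tau>)" using \<tau>(3) nonneg by (intro mult_left_mono) auto
    finally have "(\<gamma>\<^sup>2 * S) * (B + M * (1 - \<rho>)) \<le> (\<gamma>\<^sup>2 * S) * (M * (1 - \<tau>))"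
      by (rule mult_left_mono) (use nonneg in simp)
    then show ?thesis by (simp add: mult_ac)
  qed
  ultimately show ?thesis
    by (simp add: algebra_simps)
qed

lemma affine_recursion_bound:
  fixes e :: "nat \<Rightarrow> real"
  assumes step: "\<And>k. e (Suc k) \<le> (1 - \<tau>) * e k + c" and \<tau>: "0 < \<tau>" "\<tau> \<le> 1" and c: "0 \<le> c"
  shows "e k \<le> (1 - \<tau>) ^ k * e 0 + c / \<tau>"
proof (induction k)
  case 0
  then show ?case using \<tau> c by simp
next
  case (Suc k)
  have "e (Suc k) \<le> (1 - \<tau>) * e k + c" by (rule step)
  also have "\<dots> \<le> (1 - \<tau>) * ((1 - \<tau>) ^ k * e 0 + c / \<tau>) + c"
    using Suc \<tau> by (intro add_right_mono mult_left_mono) auto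
  also have "\<dots> = (1 - \<tau>) ^ Suc k * e 0 + c / \<tau>"
    using \<tau> by (simp add: field_simps)
  finally show ?case .
qed

lemma stepsize_boundD:
  assumes "ereal \<gamma> \<le> stepsize_bound \<mu> A M C" "0 < \<gamma>"
  shows "2 * \<gamma> * (A + M * C) \<le> 1"
proof (cases "A + M * C > 0")
  case True
  have "ereal \<gamma> \<le> 1 / ereal (2 * (A + M * C))"
    using assms(1) unfolding stepsize_bound_def by simp
  with True have "\<gamma> \<le> 1 / (2 * (A + M * C))" by (simp add: one_ereal_def)
  then show ?thesis using True by (simp add: pos_le_divide_eq mult_ac)
next
  case False
  \<comment> \<open>Here the quotient in the bound is \<open>\<infinity>\<close> or non-positive, and the claim holds by sign alone.\<close>
  then have "2 * \<gamma> * (A + M * C) \<le> 0"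
    using assms(2) by (simp add: mult_nonneg_nonpos)
  then show ?thesis by simp
qed

theorem theorem5p1:
  fixes F :: "'a::euclidean_space \<Rightarrow> 'a"
    and R :: "'a \<Rightarrow> ereal"
    and P :: "'w measure"
    and H :: "nat \<Rightarrow> 'w measure"
    and x h g :: "nat \<Rightarrow> 'w \<Rightarrow> 'a"
    and \<theta> :: "nat \<Rightarrow> 'w \<Rightarrow> bool"
    and \<sigma> :: "nat \<Rightarrow> 'w \<Rightarrow> real"
    and x0 h0 xs :: 'a
    and \<sigma>0 \<mu> l A B C D1 D2 \<rho> M \<gamma> p \<tau> :: real
    and K :: nat
  assumes "proper_fun R" and "lsc_fun R" and "convex_fun R"
    and "\<exists>!z. vi_solution F R z" and "vi_solution F R xs"
    and "\<mu> > 0" and "l > 0"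
    and "quasi_strongly_monotone \<mu> F xs"
    and "star_cocoercive l F xs"
    and "0 < p" and "p \<le> 1"
    and "prob_space P"
    and "history P H g \<theta> \<sigma>"
    and "independent_coins P H g \<theta> p"
    and "\<And>\<omega>. \<omega> \<in> space P \<Longrightarrow>
           proxskip_vip \<gamma> p R x0 h0 (\<lambda>k. g k \<omega>) (\<lambda>k. \<theta> k \<omega>) (\<lambda>k. x k \<omega>) (\<lambda>k. h k \<omega>)"
    and "\<And>\<omega>. \<omega> \<in> space P \<Longrightarrow> \<sigma> 0 \<omega> = \<sigma>0"
    and "estimator_assumption P H F xs x g \<sigma> A B C D1 D2 \<rho>"
    and "M > 0" and "M > B / \<rho>"
    and "\<gamma> > 0" and "ereal \<gamma> \<le> stepsize_bound \<mu> A M C"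
    and "\<tau> = min (\<gamma> * \<mu>) (min (p\<^sup>2) (\<rho> - B / M))"
  shows "integrable P (\<lambda>\<omega>. lyapunov \<gamma> p M F xs (x K \<omega>) (h K \<omega>) (\<sigma> K \<omega>)) \<and>
    prob_space.expectation P (\<lambda>\<omega>. lyapunov \<gamma> p M F xs (x K \<omega>) (h K \<omega>) (\<sigma> K \<omega>))
      \<le> (1 - \<tau>) ^ K * lyapunov \<gamma> p M F xs x0 h0 \<sigma>0 + \<gamma>\<^sup>2 * (D1 + M * D2) / \<tau>"
proof -
  note proper = assms(1) and lsc = assms(2) and conv = assms(3) and vi = assms(5)
    and \<mu> = assms(6) and l = assms(7) and qsm = assms(8) and coco = assms(9)
    and p = assms(10) and p1 = assms(11) and P = assms(12) and run = assms(15)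
    and \<sigma>_init = assms(16) and M = assms(18) and \<gamma> = assms(20)
  interpret prob_space P by (rule P)
  have H: "subalgebra P (H k)" "g k \<in> borel_measurable (H (Suc k))"
      "\<theta> k \<in> measurable (H (Suc k)) (count_space UNIV)" "\<sigma> k \<in> borel_measurable (H k)" for k
    using assms(13) unfolding history_def by auto
  have H_mono: "subalgebra (H (Suc k)) (H k)" for k
    using assms(13) H(1) filtration.sets_F_mono[of "space P" H k "Suc k"]
    unfolding history_def subalgebra_def by auto
  have est: "0 \<le> A" "0 \<le> B" "0 \<le> C" "0 \<le> D1" "0 \<le> D2" "0 < \<rho>" "\<rho> \<le> 1"
      "integrable P (g k)" "AE \<omega> in P. vec_cond_exp P (H k) (g k) \<omega> = F (x k \<omega>)"
      "AE \<omega> in P. nn_cond_exp P (H k) (\<lambda>\<omega>'. ennreal ((norm (g k \<omega>' - F xs))\<^sup>2)) \<omega>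
             \<le> ennreal (2 * A * ((F (x k \<omega>) - F xs) \<bullet> (x k \<omega> - xs)) + B * (\<sigma> k \<omega>)\<^sup>2 + D1)"
      "AE \<omega> in P. nn_cond_exp P (H k) (\<lambda>\<omega>'. ennreal ((\<sigma> (Suc k) \<omega>')\<^sup>2)) \<omega>
             \<le> ennreal (2 * C * ((F (x k \<omega>) - F xs) \<bullet> (x k \<omega> - xs)) + (1 - \<rho>) * (\<sigma> k \<omega>)\<^sup>2 + D2)" for k
    using assms(17) unfolding estimator_assumption_def by auto
  define a where "a = \<gamma> / p"
  have a: "a > 0" unfolding a_def using \<gamma> p by simp
  have T: "resolvent_point a R y (prox a R y)" for y
    by (rule prox_resolvent_point_vi[OF proper lsc conv vi a])
  have fixed_point: "resolvent_point a R (xs - a *\<^sub>R F xs) xs"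
    by (rule vi_solution_resolvent_point[OF proper vi a])
  have prox_meas: "prox a R \<in> borel_measurable borel"
    by (rule borel_measurable_continuous_onI[OF resolvent_selection_continuous[OF T a]])
  have init: "x 0 \<omega> = x0" "h 0 \<omega> = h0" if "\<omega> \<in> space P" for \<omega>
    using run[OF that] unfolding proxskip_vip_def by auto
  have x_Suc: "x (Suc k) \<omega> = (if \<theta> k \<omega> then prox a R (x k \<omega> - \<gamma> *\<^sub>R (g k \<omega> - h k \<omega>) - a *\<^sub>R h k \<omega>)
        else x k \<omega> - \<gamma> *\<^sub>R (g k \<omega> - h k \<omega>))"
    and h_Suc: "h (Suc k) \<omega> = h k \<omega> + (p / \<gamma>) *\<^sub>R (x (Suc k) \<omega> - (x k \<omega> - \<gamma> *\<^sub>R (g k \<omega> - h k \<omega>)))"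
    if "\<omega> \<in> space P" for k \<omega>
    using run[OF that] unfolding proxskip_vip_def Let_def a_def by blast+

  have meas: "x k \<in> borel_measurable (H k) \<and> h k \<in> borel_measurable (H k)" for k
  proof (induction k)
    case 0
    have "space (H 0) = space P" using H(1) unfolding subalgebra_def by auto
    then have "x 0 \<in> borel_measurable (H 0) \<longleftrightarrow> (\<lambda>_. x0) \<in> borel_measurable (H 0)"
        "h 0 \<in> borel_measurable (H 0) \<longleftrightarrow> (\<lambda>_. h0) \<in> borel_measurable (H 0)"
      by (intro measurable_cong; simp add: init)+
    then show ?case by simp
  next
    case (Suc k)
    have space: "space (H (Suc k)) = space P" using H(1) unfolding subalgebra_def by auto
    have [measurable]: "x k \<in> borel_measurable (H (Suc k))" "h k \<in> borel_measurable (H (Suc k))"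
      using Suc measurable_from_subalg[OF H_mono] by auto
    note [measurable] = H(2,3) prox_meas
    have "(\<lambda>\<omega>. if \<theta> k \<omega> then prox a R (x k \<omega> - \<gamma> *\<^sub>R (g k \<omega> - h k \<omega>) - a *\<^sub>R h k \<omega>)
        else x k \<omega> - \<gamma> *\<^sub>R (g k \<omega> - h k \<omega>)) \<in> borel_measurable (H (Suc k))"
      by measurable
    then have x_meas [measurable]: "x (Suc k) \<in> borel_measurable (H (Suc k))"
      by (subst measurable_cong[where g = "\<lambda>\<omega>. if \<theta> k \<omega>
          then prox a R (x k \<omega> - \<gamma> *\<^sub>R (g k \<omega> - h k \<omega>) - a *\<^sub>R h k \<omega>)
          else x k \<omega> - \<gamma> *\<^sub>R (g k \<omega> - h k \<omega>)"]) (simp_all add: space x_Suc)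
    have "(\<lambda>\<omega>. h k \<omega> + (p / \<gamma>) *\<^sub>R (x (Suc k) \<omega> - (x k \<omega> - \<gamma> *\<^sub>R (g k \<omega> - h k \<omega>))))
        \<in> borel_measurable (H (Suc k))"
      by measurable
    then have "h (Suc k) \<in> borel_measurable (H (Suc k))"
      by (subst measurable_cong[where g = "\<lambda>\<omega>. h k \<omega> + (p / \<gamma>) *\<^sub>R
          (x (Suc k) \<omega> - (x k \<omega> - \<gamma> *\<^sub>R (g k \<omega> - h k \<omega>)))"]) (simp_all add: space h_Suc)
    with x_meas show ?case by blast
  qed
  have measP: "x k \<in> borel_measurable P" "h k \<in> borel_measurable P" "g k \<in> borel_measurable P"
      "\<sigma> k \<in> borel_measurable P" "\<theta> k \<in> measurable P (count_space UNIV)" for k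
    using meas H measurable_from_subalg by blast+

  \<comment> \<open>The mean of the Lyapunov function is split into its three terms. As integrals they are
    informative only while \<open>sq\<close> holds, so \<open>sq\<close> is carried along in the induction.\<close>
  define X Y S where "X k = (\<integral>\<omega>. (norm (x k \<omega> - xs))\<^sup>2 \<partial>P)"
    and "Y k = \<gamma>\<^sup>2 / p\<^sup>2 * (\<integral>\<omega>. (norm (h k \<omega> - F xs))\<^sup>2 \<partial>P)"
    and "S k = (\<integral>\<omega>. (\<sigma> k \<omega>)\<^sup>2 \<partial>P)" for k
  define sq where "sq k \<longleftrightarrow> square_integrable P (\<lambda>\<omega>. x k \<omega> - xs) \<and>
    square_integrable P (\<lambda>\<omega>. h k \<omega> - F xs) \<and> square_integrable P (\<sigma> k)" for k
  define e where "e k = X k + Y k + M * \<gamma>\<^sup>2 * S k" for k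

  \<comment> \<open>The rate is a number in \<open>(0, 1]\<close>: positive because \<open>B < \<rho> M\<close>, and at most \<open>p\<^sup>2\<close>.\<close>
  have BM: "B / M < \<rho>" using assms(19) M est(6) by (simp add: field_simps)
  have \<tau>: "\<tau> \<le> \<gamma> * \<mu>" "\<tau> \<le> p\<^sup>2" "\<tau> \<le> \<rho> - B / M" "0 < \<tau>"
    using assms(22) \<gamma> \<mu> p BM by auto
  have \<tau>1: "\<tau> \<le> 1" using \<tau>(2) p p1 power_le_one[of p 2] by linarith

  have step: "sq (Suc k) \<and> e (Suc k) \<le> (1 - \<tau>) * e k + \<gamma>\<^sup>2 * (D1 + M * D2)" if "sq k" for k
  proof -
    have sq_k: "square_integrable P (\<lambda>\<omega>. x k \<omega> - xs)"
        "square_integrable P (\<lambda>\<omega>. h k \<omega> - F xs)" "square_integrable P (\<sigma> k)"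
      using that unfolding sq_def by auto
    have xk: "x k \<in> borel_measurable (H k)" using meas by blast
    define J where "J \<omega> = (vec_cond_exp P (H k) (g k) \<omega> - F xs) \<bullet> (x k \<omega> - xs)" for \<omega>
    have J_int: "integrable P J"
      unfolding J_def by (rule integrable_conditional_drift[OF P H(1) xk sq_k(1) est(9) coco l])

    have g_meas: "(\<lambda>\<omega>. (norm (g k \<omega> - F xs))\<^sup>2) \<in> borel_measurable P"
      using measP(3)[of k] by measurable
    note g_moment = estimator_moments[OF P H(1) xk sq_k(1) est(9) coco l sq_k(3) g_meas _ est(1,2,4,10),
        folded J_def, OF zero_le_power2]
    have g_sq: "square_integrable P (\<lambda>\<omega>. g k \<omega> - F xs)"
      unfolding square_integrable_def using g_moment(1) measP(3)[of k] by auto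
    have \<rho>0: "0 \<le> 1 - \<rho>" using est(7) by simp
    have \<sigma>_meas: "(\<lambda>\<omega>. (\<sigma> (Suc k) \<omega>)\<^sup>2) \<in> borel_measurable P"
      using measP(4)[of "Suc k"] by measurable
    note \<sigma>_moment = estimator_moments[OF P H(1) xk sq_k(1) est(9) coco l sq_k(3) \<sigma>_meas _ est(3) \<rho>0 est(5,11),
        folded J_def, OF zero_le_power2]

    \<comment> \<open>Unbiasedness: the mean drift of the estimator is that of its conditional mean. The constant
      \<open>F xs\<close> is subtracted on both sides after conditioning.\<close>
    have "square_integrable P (g k)"
      using square_integrable_add[OF g_sq, of "\<lambda>_. F xs"] by (simp add: square_integrable_def)
    then have "(\<integral>\<omega>. g k \<omega> \<bullet> (x k \<omega> - xs) \<partial>P) = (\<integral>\<omega>. vec_cond_exp P (H k) (g k) \<omega> \<bullet> (x k \<omega> - xs) \<partial>P)"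
      by (intro vec_cond_exp_inner[OF P H(1) _ sq_k(1)] borel_measurable_diff xk) simp_all
    moreover have const_int: "integrable P (\<lambda>\<omega>. F xs \<bullet> (x k \<omega> - xs))"
      by (rule square_integrable_inner[OF _ sq_k(1)]) (simp add: square_integrable_def)
    moreover have "(\<integral>\<omega>. g k \<omega> \<bullet> (x k \<omega> - xs) \<partial>P)
        = (\<integral>\<omega>. (g k \<omega> - F xs) \<bullet> (x k \<omega> - xs) + F xs \<bullet> (x k \<omega> - xs) \<partial>P)"
      by (simp add: inner_diff_left)
    moreover have "(\<integral>\<omega>. vec_cond_exp P (H k) (g k) \<omega> \<bullet> (x k \<omega> - xs) \<partial>P)
        = (\<integral>\<omega>. J \<omega> + F xs \<bullet> (x k \<omega> - xs) \<partial>P)"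
      by (simp add: J_def inner_diff_left)
    ultimately have mean: "(\<integral>\<omega>. (g k \<omega> - F xs) \<bullet> (x k \<omega> - xs) \<partial>P) = (\<integral>\<omega>. J \<omega> \<partial>P)"
      using J_int square_integrable_inner[OF g_sq sq_k(1)] by simp

    have drift: "\<mu> * X k \<le> (\<integral>\<omega>. J \<omega> \<partial>P)"
    proof -
      have "(\<integral>\<omega>. \<mu> * (norm (x k \<omega> - xs))\<^sup>2 \<partial>P) \<le> (\<integral>\<omega>. J \<omega> \<partial>P)"
      proof (rule integral_mono_AE)
        show "integrable P (\<lambda>\<omega>. \<mu> * (norm (x k \<omega> - xs))\<^sup>2)"
          using sq_k(1) unfolding square_integrable_def by simp
        show "AE \<omega> in P. \<mu> * (norm (x k \<omega> - xs))\<^sup>2 \<le> J \<omega>"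
          using est(9)[of k]
        proof eventually_elim
          case (elim \<omega>)
          then show ?case using qsm unfolding J_def quasi_strongly_monotone_def by simp
        qed
      qed (rule J_int)
      then show ?thesis unfolding X_def by simp
    qed

    define N where "N = sigma (space P) (sets (H k) \<union> {g k -` S \<inter> space P | S. S \<in> sets borel})"
    note N = adjoin_random_variable[OF H(1) measP(3), of k k, folded N_def]
    have coin: "measure P {\<omega> \<in> space P. \<theta> k \<omega>} = p"
        "indep_set {\<theta> k -` S \<inter> space P | S. S \<in> sets (count_space UNIV)} (sets N)"
      using assms(14) unfolding independent_coins_def N(2) by auto
    note xh = expected_skip_step_decrease[where T = "prox a R" and x = "x k" and h = "h k" and g = "g k"
        and x' = "x (Suc k)" and h' = "h (Suc k)" and flip = "\<theta> k" and hs = "F xs" and xs = xs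
        and R = R and p = p and \<gamma> = \<gamma>, folded a_def,
        OF P N(1) p \<gamma> T fixed_point coin(1) measP(5) coin(2)
          measurable_from_subalg[OF N(3) xk]
          measurable_from_subalg[OF N(3) conjunct2[OF meas]] N(4)
          measP(1,2) sq_k(1,2) g_sq x_Suc h_Suc]
    have "sq (Suc k)"
      unfolding sq_def using xh(1,2) \<sigma>_moment(1) measP(4)[of "Suc k"]
      by (simp add: square_integrable_def)
    moreover have "X (Suc k) + Y (Suc k) + M * \<gamma>\<^sup>2 * S (Suc k)
        \<le> (1 - \<tau>) * (X k + Y k + M * \<gamma>\<^sup>2 * S k) + \<gamma>\<^sup>2 * (D1 + M * D2)"
    proof (rule lyapunov_contraction_arith)
      show "X (Suc k) + Y (Suc k) \<le> X k - 2 * \<gamma> * (\<integral>\<omega>. J \<omega> \<partial>P)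
          + \<gamma>\<^sup>2 * (\<integral>\<omega>. (norm (g k \<omega> - F xs))\<^sup>2 \<partial>P) + (1 - p\<^sup>2) * Y k"
        using xh(3) unfolding X_def Y_def mean .
      show "(\<integral>\<omega>. (norm (g k \<omega> - F xs))\<^sup>2 \<partial>P) \<le> 2 * A * (\<integral>\<omega>. J \<omega> \<partial>P) + B * S k + D1"
        using g_moment(2) unfolding S_def .
      show "S (Suc k) \<le> 2 * C * (\<integral>\<omega>. J \<omega> \<partial>P) + (1 - \<rho>) * S k + D2"
        using \<sigma>_moment(2) unfolding S_def .
      show "2 * \<gamma> * (A + M * C) \<le> 1" by (rule stepsize_boundD[OF assms(21) \<gamma>])
    qed (use drift \<mu> \<gamma> M \<tau> in \<open>auto simp: X_def Y_def S_def\<close>)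
    ultimately show ?thesis unfolding e_def by blast
  qed

  have sq0: "sq 0"
    unfolding sq_def
    by (intro conjI; rule square_integrable_deterministic[OF P]) (simp_all add: init \<sigma>_init)
  have sq: "sq k" for k by (induction k) (use sq0 step in auto)
  have V_int: "integrable P (\<lambda>\<omega>. lyapunov \<gamma> p M F xs (x k \<omega>) (h k \<omega>) (\<sigma> k \<omega>))"
    and V_mean: "(\<integral>\<omega>. lyapunov \<gamma> p M F xs (x k \<omega>) (h k \<omega>) (\<sigma> k \<omega>) \<partial>P) = e k" for k
    using sq[of k] unfolding sq_def lyapunov_def square_integrable_def e_def X_def Y_def S_def by simp_all
  have "e 0 = (\<integral>\<omega>. lyapunov \<gamma> p M F xs x0 h0 \<sigma>0 \<partial>P)"
    unfolding V_mean[symmetric]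
    by (rule Bochner_Integration.integral_cong) (simp_all add: init \<sigma>_init)
  then have e0: "e 0 = lyapunov \<gamma> p M F xs x0 h0 \<sigma>0" by (simp add: prob_space)
  have "e K \<le> (1 - \<tau>) ^ K * e 0 + \<gamma>\<^sup>2 * (D1 + M * D2) / \<tau>"
    by (rule affine_recursion_bound) (use step sq \<tau> \<tau>1 est M in auto)
  then show ?thesis using V_int V_mean e0 by simp
qed

end
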